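(* A finite semiprimitive group with at least two plinths is graph-restrictive.
   Context: A permutation group is semiregular if all its point-stabilisers are trivial. A transitive permutation group $G$ is semiprimitive if every normal subgroup of $G$ is transitive or semiregular. A plinth of a transitive permutation group $G$ is a minimally transitive normal subgroup, i.e. a transitive normal subgroup $K$ of $G$ such that no proper subgroup of $K$ that is normal in $G$ is transitive. Let $\Gamma$ be a locally finite graph and let $G\leqslant\mathrm{Aut}(\Gamma)$ be vertex-transitive. For a vertex $x$, $G_x^{\Gamma(x)}$ is the permutation group induced by the stabiliser $G_x$ on the neighbourhood $\Gamma(x)$ of $x$ in $\Gamma$. For a permutation group $L$, the pair $(\Gamma,G)$ is called locally $L$ if $G_x^{\Gamma(x)}$ is permutation isomorphic to $L$ for each vertex $x$. A finite permutation group $L$ is graph-restrictive if there exists a constant $c=c(L)$ such that for every locally $L$ pair $(\Gamma,G)$ one has $|G_x|\leqslant c$ for a vertex $x$ of $\Gamma$.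
   Formalization: In the definition of graph-restrictive, Γ is taken connected and the vertex stabilisers G_x finite, since the claim fails otherwise; vertices are natural numbers, which loses nothing because connected locally finite graphs are countable. *)

theory Defs
  imports "HOL-Algebra.Algebra" "HOL-Library.Countable_Set"
begin

section \<open>Permutation groups\<close>

text \<open>A permutation group on \<open>S\<close> is a subgroup of \<^term>\<open>BijGroup S\<close>; it is given by its set of
  elements, which are bijections of \<open>S\<close> that are \<^term>\<open>undefined\<close> outside \<open>S\<close>.\<close>

abbreviation perm_group :: "'a set \<Rightarrow> ('a \<Rightarrow> 'a) set \<Rightarrow> bool" where
  "perm_group S G \<equiv> subgroup G (BijGroup S)"

abbreviation perm_grp :: "'a set \<Rightarrow> ('a \<Rightarrow> 'a) set \<Rightarrow> ('a \<Rightarrow> 'a) monoid" where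
  "perm_grp S G \<equiv> (BijGroup S)\<lparr>carrier := G\<rparr>"

abbreviation point_stabiliser :: "'a set \<Rightarrow> ('a \<Rightarrow> 'a) set \<Rightarrow> 'a \<Rightarrow> ('a \<Rightarrow> 'a) set" where
  "point_stabiliser S G x \<equiv> stabilizer (perm_grp S G) (\<lambda>g. g) x"

definition transitive :: "'a set \<Rightarrow> ('a \<Rightarrow> 'a) set \<Rightarrow> bool" where
  "transitive S G \<longleftrightarrow> transitive_action (perm_grp S G) S (\<lambda>g. g)"

definition semiregular :: "'a set \<Rightarrow> ('a \<Rightarrow> 'a) set \<Rightarrow> bool" where
  "semiregular S G \<longleftrightarrow> (\<forall>x\<in>S. point_stabiliser S G x = {\<one>\<^bsub>BijGroup S\<^esub>})"

definition semiprimitive :: "'a set \<Rightarrow> ('a \<Rightarrow> 'a) set \<Rightarrow> bool" where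
  "semiprimitive S G \<longleftrightarrow> transitive S G \<and>
     (\<forall>N. N \<lhd> perm_grp S G \<longrightarrow> transitive S N \<or> semiregular S N)"

definition plinth :: "'a set \<Rightarrow> ('a \<Rightarrow> 'a) set \<Rightarrow> ('a \<Rightarrow> 'a) set \<Rightarrow> bool" where
  "plinth S G K \<longleftrightarrow> transitive S G \<and> K \<lhd> perm_grp S G \<and> transitive S K \<and>
     (\<forall>M. M \<lhd> perm_grp S G \<and> M \<subset> K \<longrightarrow> \<not> transitive S M)"

definition perm_isomorphic ::
  "'a set \<Rightarrow> ('a \<Rightarrow> 'a) set \<Rightarrow> 'b set \<Rightarrow> ('b \<Rightarrow> 'b) set \<Rightarrow> bool" where
  "perm_isomorphic S G T H \<longleftrightarrow>
     (\<exists>f \<psi>. bij_betw f S T \<and> \<psi> \<in> iso (perm_grp S G) (perm_grp T H) \<and>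
        (\<forall>g\<in>G. \<forall>x\<in>S. f (g x) = \<psi> g (f x)))"


section \<open>Graphs and graph-restrictive groups\<close>

text \<open>A graph has vertex set \<open>V\<close> and a symmetric irreflexive adjacency relation \<open>E\<close> on \<open>V\<close>;
  the neighbourhood of \<open>x\<close> is \<open>E `` {x}\<close>.\<close>

definition simple_graph :: "'v set \<Rightarrow> 'v rel \<Rightarrow> bool" where
  "simple_graph V E \<longleftrightarrow> E \<subseteq> V \<times> V \<and> sym E \<and> irrefl E"

definition connected_graph :: "'v set \<Rightarrow> 'v rel \<Rightarrow> bool" where
  "connected_graph V E \<longleftrightarrow> (\<forall>x\<in>V. \<forall>y\<in>V. (x, y) \<in> E\<^sup>*)"

definition locally_finite :: "'v set \<Rightarrow> 'v rel \<Rightarrow> bool" where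
  "locally_finite V E \<longleftrightarrow> (\<forall>x\<in>V. finite (E `` {x}))"

definition graph_aut :: "'v set \<Rightarrow> 'v rel \<Rightarrow> ('v \<Rightarrow> 'v) set" where
  "graph_aut V E = {g \<in> Bij V. \<forall>x\<in>V. \<forall>y\<in>V. (g x, g y) \<in> E \<longleftrightarrow> (x, y) \<in> E}"

definition local_group :: "'v set \<Rightarrow> 'v rel \<Rightarrow> ('v \<Rightarrow> 'v) set \<Rightarrow> 'v \<Rightarrow> ('v \<Rightarrow> 'v) set" where
  "local_group V E G x = (\<lambda>g. restrict g (E `` {x})) ` point_stabiliser V G x"

definition locally_pair ::
  "'a set \<Rightarrow> ('a \<Rightarrow> 'a) set \<Rightarrow> 'v set \<Rightarrow> 'v rel \<Rightarrow> ('v \<Rightarrow> 'v) set \<Rightarrow> bool" where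
  "locally_pair S L V E G \<longleftrightarrow>
     simple_graph V E \<and> connected_graph V E \<and> locally_finite V E \<and>
     perm_group V G \<and> G \<subseteq> graph_aut V E \<and> transitive V G \<and>
     (\<forall>x\<in>V. perm_isomorphic (E `` {x}) (local_group V E G x) S L)"

text \<open>The constant \<open>c\<close> has to serve all graphs at once, so the vertices must range over one fixed
  type. Since a connected locally finite graph is countable, vertex sets \<open>V :: nat set\<close> lose
  nothing: see \<open>graph_restrictive_any_vertex_type\<close> below.

  The pairs are those with connected graph (part of \<^const>\<open>locally_pair\<close>) and finite vertex
  stabilisers. Without these standing assumptions of the subject no group with a nontrivial
  point-stabiliser would be graph-restrictive: take disjoint copies of a graph, respectively the
  universal group with local action \<open>L\<close> on a regular tree.\<close>

definition graph_restrictive :: "'a set \<Rightarrow> ('a \<Rightarrow> 'a) set \<Rightarrow> bool" where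
  "graph_restrictive S L \<longleftrightarrow>
     (\<exists>c::nat. \<forall>(V :: nat set) E G. locally_pair S L V E G \<longrightarrow>
        (\<forall>x\<in>V. finite (point_stabiliser V G x)) \<longrightarrow>
        (\<forall>x\<in>V. card (point_stabiliser V G x) \<le> c))"


section \<open>Independence of the vertex type\<close>

lemma point_stabiliser_eq: "point_stabiliser S G x = {g \<in> G. g x = x}"
  by (simp add: stabilizer_def)

lemma BijGroup_mult: "g \<in> Bij S \<Longrightarrow> h \<in> Bij S \<Longrightarrow> g \<otimes>\<^bsub>BijGroup S\<^esub> h = compose S g h"
  by (simp add: BijGroup_def)

lemma transitive_iff:
  assumes "perm_group S G"
  shows "transitive S G \<longleftrightarrow> (\<forall>x\<in>S. \<forall>y\<in>S. \<exists>g\<in>G. g x = y)"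
proof -
  have "(\<lambda>g. g) \<in> hom (perm_grp S G) (BijGroup S)"
    using subgroup.subset[OF assms] by (auto simp: hom_def)
  then have "group_action (perm_grp S G) S (\<lambda>g. g)"
    using subgroup.subgroup_is_group[OF assms group_BijGroup] group_BijGroup[of S]
    by (simp add: group_action_def group_hom_def group_hom_axioms_def)
  then show ?thesis
    by (auto simp: transitive_def transitive_action_def transitive_action_axioms_def)
qed

lemma perm_isomorphic_trans:
  assumes "perm_isomorphic S G T H" "perm_isomorphic T H U K"
  shows "perm_isomorphic S G U K"
proof -
  obtain f \<psi> where 1: "bij_betw f S T" "\<psi> \<in> iso (perm_grp S G) (perm_grp T H)"
    "\<And>g x. g \<in> G \<Longrightarrow> x \<in> S \<Longrightarrow> f (g x) = \<psi> g (f x)"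
    using assms(1) unfolding perm_isomorphic_def by blast
  obtain f' \<psi>' where 2: "bij_betw f' T U" "\<psi>' \<in> iso (perm_grp T H) (perm_grp U K)"
    "\<And>g x. g \<in> H \<Longrightarrow> x \<in> T \<Longrightarrow> f' (g x) = \<psi>' g (f' x)"
    using assms(2) unfolding perm_isomorphic_def by blast
  have "\<psi>' \<circ> \<psi> \<in> iso (perm_grp S G) (perm_grp U K)"
    using 1(2) 2(2) by (rule iso_set_trans)
  moreover have "(f' \<circ> f) (g x) = (\<psi>' \<circ> \<psi>) g ((f' \<circ> f) x)" if "g \<in> G" "x \<in> S" for g x
  proof -
    have "\<psi> g \<in> H" using 1(2) that by (auto simp: iso_def hom_def)
    moreover have "f x \<in> T" using 1(1) that by (auto simp: bij_betw_def)
    ultimately show ?thesis using 1(3) 2(3) that by simp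
  qed
  ultimately show ?thesis
    unfolding perm_isomorphic_def using bij_betw_trans[OF 1(1) 2(1)] by blast
qed

definition transport :: "('a \<Rightarrow> 'b) \<Rightarrow> 'a set \<Rightarrow> ('a \<Rightarrow> 'a) \<Rightarrow> ('b \<Rightarrow> 'b)" where
  "transport f S g = (\<lambda>y\<in>f ` S. f (g (inv_into S f y)))"

context
  fixes f :: "'a \<Rightarrow> 'b" and S
  assumes inj: "inj_on f S"
begin

lemma transport_apply: "x \<in> S \<Longrightarrow> transport f S g (f x) = f (g x)"
  using inj by (simp add: transport_def)

lemma Bij_closed: "g \<in> Bij S \<Longrightarrow> x \<in> S \<Longrightarrow> g x \<in> S"
  using Bij_imp_funcset by blast

lemma transport_Bij:
  assumes "g \<in> Bij S" shows "transport f S g \<in> Bij (f ` S)"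
proof -
  have g: "bij_betw g S S" using assms by (simp add: Bij_def)
  have "inj_on (transport f S g) (f ` S)"
  proof (rule inj_onI)
    fix y z assume "y \<in> f ` S" "z \<in> f ` S" and eq: "transport f S g y = transport f S g z"
    then obtain u v where uv: "y = f u" "z = f v" "u \<in> S" "v \<in> S" by blast
    then have "g u = g v" using eq inj assms by (simp add: transport_apply Bij_closed inj_on_eq_iff)
    then show "y = z" using uv g by (auto simp: bij_betw_def dest: inj_onD)
  qed
  moreover have "transport f S g ` f ` S = f ` S"
    using g by (force simp: image_image transport_apply bij_betw_def)
  ultimately show ?thesis by (simp add: Bij_def bij_betw_def transport_def)
qed

lemma transport_inj: "inj_on (transport f S) (Bij S)"
proof (rule inj_onI)
  fix g h assume gh: "g \<in> Bij S" "h \<in> Bij S" and eq: "transport f S g = transport f S h"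
  show "g = h"
  proof (rule extensionalityI)
    show "g \<in> extensional S" "h \<in> extensional S" using gh by (simp_all add: Bij_def)
    fix x assume x: "x \<in> S"
    have "f (g x) = f (h x)" using transport_apply[OF x] eq by metis
    then show "g x = h x" using inj gh x by (meson inj_onD Bij_closed)
  qed
qed

lemma transport_mult:
  assumes "g \<in> Bij S" "h \<in> Bij S"
  shows "transport f S (g \<otimes>\<^bsub>BijGroup S\<^esub> h) =
    transport f S g \<otimes>\<^bsub>BijGroup (f ` S)\<^esub> transport f S h"
proof -
  have "transport f S (compose S g h) = compose (f ` S) (transport f S g) (transport f S h)"
  proof (rule extensionalityI)
    show "transport f S (compose S g h) \<in> extensional (f ` S)" by (simp add: transport_def)
    show "compose (f ` S) (transport f S g) (transport f S h) \<in> extensional (f ` S)" by simp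
    fix y assume "y \<in> f ` S"
    then obtain x where "x \<in> S" "y = f x" by blast
    then show "transport f S (compose S g h) y =
        compose (f ` S) (transport f S g) (transport f S h) y"
      using assms by (simp add: transport_apply compose_eq Bij_closed)
  qed
  then show ?thesis using assms by (simp add: BijGroup_mult transport_Bij)
qed

lemma transport_group_hom: "group_hom (BijGroup S) (BijGroup (f ` S)) (transport f S)"
proof -
  have "transport f S \<in> hom (BijGroup S) (BijGroup (f ` S))"
    using transport_Bij transport_mult by (intro homI) (simp_all add: BijGroup_def)
  then show ?thesis
    by (simp add: group_hom_def group_hom_axioms_def group_BijGroup)
qed

lemma transport_perm_group: "perm_group S G \<Longrightarrow> perm_group (f ` S) (transport f S ` G)"
  using group_hom.subgroup_img_is_subgroup[OF transport_group_hom] .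

lemma transport_perm_isomorphic:
  assumes "G \<subseteq> Bij S"
  shows "perm_isomorphic S G (f ` S) (transport f S ` G)"
proof -
  have "bij_betw (transport f S) G (transport f S ` G)"
    using transport_inj assms by (meson inj_on_imp_bij_betw inj_on_subset)
  moreover have "transport f S \<in> hom (perm_grp S G) (perm_grp (f ` S) (transport f S ` G))"
    using assms by (auto simp: hom_def transport_mult subsetD)
  ultimately have "transport f S \<in> iso (perm_grp S G) (perm_grp (f ` S) (transport f S ` G))"
    by (simp add: iso_def)
  moreover have "bij_betw f S (f ` S)" using inj by (rule inj_on_imp_bij_betw)
  ultimately show ?thesis
    unfolding perm_isomorphic_def using transport_apply by metis
qed

end

lemma transport_inv:
  assumes inj: "inj_on f S" and g: "g \<in> Bij S"
  shows "transport (inv_into S f) (f ` S) (transport f S g) = g"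
proof (rule extensionalityI)
  have im: "inv_into S f ` f ` S = S" using inj by simp
  have inj': "inj_on (inv_into S f) (f ` S)" by (simp add: inj_on_inv_into)
  show "transport (inv_into S f) (f ` S) (transport f S g) \<in> extensional S"
    unfolding transport_def im by simp
  show "g \<in> extensional S" using g by (simp add: Bij_def)
  fix x assume x: "x \<in> S"
  then have "transport (inv_into S f) (f ` S) (transport f S g) (inv_into S f (f x)) =
      inv_into S f (transport f S g (f x))"
    by (intro transport_apply[OF inj']) simp
  then show "transport (inv_into S f) (f ` S) (transport f S g) x = g x"
    using x inj g by (simp add: transport_apply Bij_closed)
qed

lemma transport_perm_isomorphic_inv:
  assumes inj: "inj_on f S" and G: "G \<subseteq> Bij S"
  shows "perm_isomorphic (f ` S) (transport f S ` G) S G"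
proof -
  have "perm_isomorphic (f ` S) (transport f S ` G) (inv_into S f ` f ` S)
      (transport (inv_into S f) (f ` S) ` transport f S ` G)"
    using transport_Bij[OF inj] G
    by (intro transport_perm_isomorphic) (auto simp: inj_on_inv_into)
  moreover have "inv_into S f ` f ` S = S" using inj by simp
  moreover have "transport (inv_into S f) (f ` S) ` transport f S ` G = G"
  proof -
    have "transport (inv_into S f) (f ` S) (transport f S g) = g" if "g \<in> G" for g
      using transport_inv[OF inj] that G by blast
    then show ?thesis by (simp add: image_image)
  qed
  ultimately show ?thesis by simp
qed

lemma local_group_subset_Bij:
  assumes "simple_graph V E" "G \<subseteq> graph_aut V E" "x \<in> V"
  shows "local_group V E G x \<subseteq> Bij (E `` {x})"
proof
  fix h assume "h \<in> local_group V E G x"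
  then obtain g where g: "g \<in> G" "g x = x" and h: "h = restrict g (E `` {x})"
    by (auto simp: local_group_def point_stabiliser_eq)
  have V: "E `` {x} \<subseteq> V" using assms(1) by (auto simp: simple_graph_def)
  have gB: "bij_betw g V V" and gE: "\<And>u v. u \<in> V \<Longrightarrow> v \<in> V \<Longrightarrow> (g u, g v) \<in> E \<longleftrightarrow> (u, v) \<in> E"
    using assms(2) g(1) by (auto simp: graph_aut_def Bij_def)
  have "g ` (E `` {x}) = E `` {x}"
  proof
    show "g ` (E `` {x}) \<subseteq> E `` {x}"
      using gE[OF assms(3)] g(2) V by force
    show "E `` {x} \<subseteq> g ` (E `` {x})"
    proof
      fix y assume y: "y \<in> E `` {x}"
      then obtain z where "z \<in> V" "y = g z" using V gB by (auto simp: bij_betw_def)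
      then show "y \<in> g ` (E `` {x})" using gE[OF assms(3), of z] g(2) y by auto
    qed
  qed
  moreover have "inj_on g (E `` {x})" using gB V by (meson bij_betw_def inj_on_subset)
  ultimately have "bij_betw h (E `` {x}) (E `` {x})"
    by (simp add: h bij_betw_def)
  then show "h \<in> Bij (E `` {x})" by (simp add: h Bij_def)
qed

lemma countable_connected:
  assumes "simple_graph V E" "connected_graph V E" "locally_finite V E"
  shows "countable V"
proof (cases "V = {}")
  case False
  then obtain x where x: "x \<in> V" by blast
  have EV: "E \<subseteq> V \<times> V" using assms(1) by (simp add: simple_graph_def)
  have step: "(E ^^ Suc n) `` {x} = (\<Union>y\<in>(E ^^ n) `` {x}. E `` {y})" for n by auto
  have "finite ((E ^^ n) `` {x}) \<and> (E ^^ n) `` {x} \<subseteq> V" for n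
  proof (induction n)
    case 0 then show ?case using x by simp
  next
    case (Suc n)
    then show ?case unfolding step using assms(3) EV by (auto simp: locally_finite_def)
  qed
  then have "countable (\<Union>n. (E ^^ n) `` {x})" by (simp add: countable_finite)
  moreover have "V \<subseteq> (\<Union>n. (E ^^ n) `` {x})"
    using assms(2) x by (auto simp: connected_graph_def rtrancl_power)
  ultimately show ?thesis by (rule countable_subset[rotated])
qed simp

lemma transport_locally_pair:
  assumes pair: "locally_pair S L V E G" and inj: "inj_on f V"
  shows "locally_pair S L (f ` V) (map_prod f f ` E) (transport f V ` G)"
proof -
  let ?E = "map_prod f f ` E" and ?G = "transport f V ` G"
  have sg: "simple_graph V E" and con: "connected_graph V E" and lf: "locally_finite V E"
    and G: "perm_group V G" and aut: "G \<subseteq> graph_aut V E" and tr: "transitive V G"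
    and loc: "\<And>x. x \<in> V \<Longrightarrow> perm_isomorphic (E `` {x}) (local_group V E G x) S L"
    using pair by (auto simp: locally_pair_def)
  have EV: "E \<subseteq> V \<times> V" using sg by (simp add: simple_graph_def)
  have GB: "G \<subseteq> Bij V" using aut by (auto simp: graph_aut_def)
  have E_iff: "(f u, f v) \<in> ?E \<longleftrightarrow> (u, v) \<in> E" if "u \<in> V" "v \<in> V" for u v
  proof
    assume "(f u, f v) \<in> ?E"
    then obtain a b where ab: "(a, b) \<in> E" "f u = f a" "f v = f b" by auto
    then have "u = a" "v = b" using EV that inj by (auto dest: inj_onD)
    then show "(u, v) \<in> E" using ab by simp
  qed force
  have nb: "?E `` {f x} = f ` (E `` {x})" if "x \<in> V" for x
  proof
    show "?E `` {f x} \<subseteq> f ` (E `` {x})"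
    proof
      fix y assume y: "y \<in> ?E `` {f x}"
      then obtain z where "z \<in> V" "y = f z" using EV by auto
      then show "y \<in> f ` (E `` {x})" using y that E_iff by auto
    qed
  qed force
  have sg': "simple_graph (f ` V) ?E"
    unfolding simple_graph_def
  proof (intro conjI)
    show "?E \<subseteq> f ` V \<times> f ` V" using EV by auto
    show "sym ?E" using sg by (force simp: simple_graph_def sym_def)
    show "irrefl ?E" using sg EV E_iff
      by (auto simp: simple_graph_def irrefl_def) (metis SigmaE2 inj inj_onD subsetD)
  qed
  have path: "(f u, f v) \<in> ?E\<^sup>*" if "(u, v) \<in> E\<^sup>*" for u v
    using that
  proof (induction rule: rtrancl_induct)
    case (step y z)
    then have "(f y, f z) \<in> ?E" by force
    with step.IH show ?case by (rule rtrancl_into_rtrancl)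
  qed simp
  then have con': "connected_graph (f ` V) ?E"
    using con by (auto simp: connected_graph_def)
  have lf': "locally_finite (f ` V) ?E"
    using lf nb by (auto simp: locally_finite_def)
  have G': "perm_group (f ` V) ?G" using transport_perm_group[OF inj G] .
  have aut': "?G \<subseteq> graph_aut (f ` V) ?E"
  proof
    fix h assume "h \<in> ?G"
    then obtain g where g: "g \<in> G" "h = transport f V g" by blast
    have gB: "g \<in> Bij V" using g GB by blast
    have "(h (f u), h (f v)) \<in> ?E \<longleftrightarrow> (f u, f v) \<in> ?E" if "u \<in> V" "v \<in> V" for u v
      using that g aut gB
      by (auto simp: transport_apply[OF inj] E_iff Bij_closed[OF inj] graph_aut_def simp del: map_prod_imageI)
    then show "h \<in> graph_aut (f ` V) ?E"
      using transport_Bij[OF inj gB] g by (auto simp: graph_aut_def)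
  qed
  have tr': "transitive (f ` V) ?G"
    using tr transport_apply[OF inj] by (fastforce simp: transitive_iff[OF G] transitive_iff[OF G'])
  have loc': "perm_isomorphic (?E `` {f x}) (local_group (f ` V) ?E ?G (f x)) S L"
    if x: "x \<in> V" for x
  proof -
    let ?N = "E `` {x}"
    have NV: "?N \<subseteq> V" using EV by auto
    have injN: "inj_on f ?N" using inj NV by (rule inj_on_subset)
    have stab: "point_stabiliser (f ` V) ?G (f x) = transport f V ` point_stabiliser V G x"
    proof -
      have "transport f V g (f x) = f x \<longleftrightarrow> g x = x" if "g \<in> G" for g
        using that GB x inj by (auto simp: transport_apply[OF inj] Bij_closed[OF inj] inj_on_eq_iff)
      then show ?thesis by (auto simp: point_stabiliser_eq)
    qed
    have "restrict (transport f V g) (f ` ?N) = transport f ?N (restrict g ?N)" for g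
    proof (rule extensionalityI)
      show "restrict (transport f V g) (f ` ?N) \<in> extensional (f ` ?N)" by simp
      show "transport f ?N (restrict g ?N) \<in> extensional (f ` ?N)" by (simp add: transport_def)
      fix y assume "y \<in> f ` ?N"
      then obtain z where z: "z \<in> ?N" "y = f z" by blast
      then have "z \<in> V" using NV by blast
      then show "restrict (transport f V g) (f ` ?N) y = transport f ?N (restrict g ?N) y"
        using z by (auto simp: transport_apply[OF inj] transport_apply[OF injN])
    qed
    then have "local_group (f ` V) ?E ?G (f x) = transport f ?N ` local_group V E G x"
      unfolding local_group_def nb[OF x] stab by (simp add: image_image)
    then have "perm_isomorphic (?E `` {f x}) (local_group (f ` V) ?E ?G (f x)) ?N (local_group V E G x)"
      unfolding nb[OF x]
      using transport_perm_isomorphic_inv[OF injN local_group_subset_Bij[OF sg aut x]] by simp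
    then show ?thesis using loc[OF x] by (rule perm_isomorphic_trans)
  qed
  show ?thesis
    unfolding locally_pair_def using sg' con' lf' G' aut' tr' loc' by blast
qed

theorem graph_restrictive_any_vertex_type:
  fixes V :: "'v set"
  assumes bound: "\<And>(V :: nat set) E G. locally_pair S L V E G \<Longrightarrow>
        \<forall>x\<in>V. finite (point_stabiliser V G x) \<Longrightarrow>
        \<forall>x\<in>V. card (point_stabiliser V G x) \<le> c"
    and pair: "locally_pair S L V E G"
    and fin: "\<forall>x\<in>V. finite (point_stabiliser V G x)"
  shows "\<forall>x\<in>V. card (point_stabiliser V G x) \<le> c"
proof
  fix x assume x: "x \<in> V"
  have "countable V" using pair countable_connected by (auto simp: locally_pair_def)
  then obtain f :: "'v \<Rightarrow> nat" where inj: "inj_on f V" by (auto simp: countable_def)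
  have GB: "G \<subseteq> Bij V" using pair by (auto simp: locally_pair_def graph_aut_def)
  have stab: "point_stabiliser (f ` V) (transport f V ` G) (f y) =
      transport f V ` point_stabiliser V G y" if "y \<in> V" for y
  proof -
    have "transport f V g (f y) = f y \<longleftrightarrow> g y = y" if "g \<in> G" for g
      using that GB \<open>y \<in> V\<close> inj
      by (auto simp: transport_apply[OF inj] Bij_closed[OF inj] inj_on_eq_iff)
    then show ?thesis by (auto simp: point_stabiliser_eq)
  qed
  have "card (point_stabiliser (f ` V) (transport f V ` G) (f x)) \<le> c"
    using bound[OF transport_locally_pair[OF pair inj]] fin stab x by simp
  moreover have "inj_on (transport f V) (point_stabiliser V G x)"
    using transport_inj[OF inj] GB by (auto simp: point_stabiliser_eq intro: inj_on_subset)
  ultimately show "card (point_stabiliser V G x) \<le> c"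
    by (simp add: stab[OF x] card_image)
qed

end

theory Submission
  imports Defs
begin

text \<open>Let \<open>K1\<close> and \<open>K2\<close> be distinct plinths and let \<open>U\<close> be an abelian normal subgroup of the
  point stabiliser \<open>L\<^sub>w\<close>. Then \<open>J = U K2 \<inter> K1\<close> is normal in \<open>L\<close> and abelian modulo
  \<open>I = K1 \<inter> K2\<close>, which is intransitive. In a semiprimitive group an intransitive normal subgroup
  is the full kernel of the action on its orbits. If \<open>J = K1\<close>, then \<open>K1\<close> acts on the
  \<open>I\<close>-orbits as a transitive abelian group centralised by \<open>K2\<close>, which forces \<open>K2 \<subseteq> K1\<close>.
  Otherwise \<open>J\<close> is intransitive; since \<open>[U, K1] \<subseteq> J\<close>, the group \<open>U\<close> preserves each
  \<open>J\<close>-orbit, so that \<open>U \<subseteq> J\<close> and \<open>U = 1\<close> by semiregularity. Hence \<open>L\<^sub>w\<close> has no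
  nontrivial abelian normal subgroup.

  For a semiprimitive \<open>L\<close> with this property there is a short form of the Thompson-Wielandt
  argument. Let \<open>A\<close> be the stabiliser of an arc \<open>(x, y)\<close> and \<open>K\<close> the kernel of \<open>G\<^sub>x\<close> on the
  neighbourhood of \<open>x\<close>. As \<open>A/K\<close> is \<open>L\<^sub>w\<close>, the soluble radicals of \<open>A\<close> and \<open>K\<close>
  coincide; being normalised by \<open>G\<^sub>x\<close> and by the edge stabiliser, this group is trivial. If
  the centraliser \<open>C\<close> of \<open>K\<close> in \<open>G\<^sub>x\<close> satisfies \<open>C \<inter> A \<subseteq> K\<close>, then \<open>A\<close> and \<open>K\<close>
  have the same socle, which is trivial for the same reason, and \<open>A = 1\<close>. Otherwise \<open>C\<close> is
  transitive on the neighbourhood of \<open>x\<close>, so \<open>G\<^sub>x = C A\<close> normalises the pointwise stabiliser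
  of the two neighbourhoods, which is therefore trivial. So \<open>G\<^sub>x\<close> has order at most
  \<open>|L|\<^sup>2\<close>.\<close>

section \<open>Soluble radical and socle\<close>

context group
begin

section \<open>Conjugation, commutators and relative normality\<close>

definition conjugate :: "'a \<Rightarrow> 'a \<Rightarrow> 'a" where
  "conjugate g x = g \<otimes> x \<otimes> inv g"

definition commutator :: "'a \<Rightarrow> 'a \<Rightarrow> 'a" where
  "commutator a b = a \<otimes> b \<otimes> inv a \<otimes> inv b"

text \<open>A relation between subsets of one ambient group, so that chains such as
  \<open>K\<close>, \<open>A\<close>, \<open>P\<close> need no change of carrier;
  \<open>normal_in_iff\<close> links it to normality in the group with carrier
  \<open>H\<close>.\<close>

definition normal_in :: "'a set \<Rightarrow> 'a set \<Rightarrow> bool" where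
  "normal_in N H \<longleftrightarrow> subgroup N G \<and> N \<subseteq> H \<and> (\<forall>h\<in>H. \<forall>n\<in>N. conjugate h n \<in> N)"

text \<open>For \<open>M\<close> normal in \<open>H\<close> and \<open>B\<close> inside
  \<open>H\<close> this is the preimage of the centraliser of the image of \<open>B\<close> in
  \<open>H/M\<close>. Commutators replace the quotient group, and \<open>M = {\<one>}\<close> gives
  the ordinary centraliser.\<close>

definition centraliser_mod :: "'a set \<Rightarrow> 'a set \<Rightarrow> 'a set \<Rightarrow> 'a set" where
  "centraliser_mod M H B = {a \<in> H. \<forall>b\<in>B. commutator a b \<in> M}"

lemma cancel_inv_left [simp]:
  assumes "x \<in> carrier G" "y \<in> carrier G"
  shows "inv x \<otimes> (x \<otimes> y) = y" "x \<otimes> (inv x \<otimes> y) = y"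
  using assms by (simp_all add: m_assoc[symmetric])

lemma conjugate_closed [simp]:
  "g \<in> carrier G \<Longrightarrow> x \<in> carrier G \<Longrightarrow> conjugate g x \<in> carrier G"
  by (simp add: conjugate_def)

lemma commutator_closed [simp]:
  "a \<in> carrier G \<Longrightarrow> b \<in> carrier G \<Longrightarrow> commutator a b \<in> carrier G"
  by (simp add: commutator_def)

lemma conjugate_mult:
  assumes "g \<in> carrier G" "x \<in> carrier G" "y \<in> carrier G"
  shows "conjugate g (x \<otimes> y) = conjugate g x \<otimes> conjugate g y"
  using assms by (simp add: conjugate_def m_assoc)

lemma conjugate_conjugate:
  assumes "g \<in> carrier G" "h \<in> carrier G" "x \<in> carrier G"
  shows "conjugate g (conjugate h x) = conjugate (g \<otimes> h) x"
  using assms by (simp add: conjugate_def m_assoc inv_mult_group)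

lemma conjugate_one [simp]: "x \<in> carrier G \<Longrightarrow> conjugate \<one> x = x"
  "g \<in> carrier G \<Longrightarrow> conjugate g \<one> = \<one>"
  by (simp_all add: conjugate_def)

lemma conjugate_inv:
  assumes "g \<in> carrier G" "x \<in> carrier G"
  shows "conjugate g (inv x) = inv (conjugate g x)"
  using assms by (simp add: conjugate_def m_assoc inv_mult_group)

lemma conjugate_inv_cancel [simp]:
  assumes "g \<in> carrier G" "x \<in> carrier G"
  shows "conjugate (inv g) (conjugate g x) = x" "conjugate g (conjugate (inv g) x) = x"
  using assms by (simp_all add: conjugate_conjugate)

lemma conjugate_commutator:
  assumes "g \<in> carrier G" "x \<in> carrier G" "y \<in> carrier G"
  shows "conjugate g (commutator x y) = commutator (conjugate g x) (conjugate g y)"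
  using assms by (simp add: commutator_def conjugate_mult conjugate_inv)

lemma commutator_mult_left:
  assumes "a \<in> carrier G" "b \<in> carrier G" "c \<in> carrier G"
  shows "commutator (a \<otimes> b) c = conjugate a (commutator b c) \<otimes> commutator a c"
  using assms by (simp add: commutator_def conjugate_def m_assoc inv_mult_group)

lemma commutator_inv_left:
  assumes "a \<in> carrier G" "c \<in> carrier G"
  shows "commutator (inv a) c = inv (conjugate (inv a) (commutator a c))"
  using assms by (simp add: commutator_def conjugate_def m_assoc inv_mult_group)

lemma commutator_swap:
  assumes "a \<in> carrier G" "b \<in> carrier G"
  shows "commutator b a = inv (commutator a b)"
  using assms by (simp add: commutator_def m_assoc inv_mult_group)

text \<open>The first form puts the commutator into every subgroup that contains \<open>b\<close>
  and is normalised by \<open>a\<close>, the second into every subgroup that contains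
  \<open>a\<close> and is normalised by \<open>b\<close>.\<close>

lemma commutator_conjugate:
  assumes "a \<in> carrier G" "b \<in> carrier G"
  shows "commutator a b = conjugate a b \<otimes> inv b" "commutator a b = a \<otimes> inv (conjugate b a)"
  using assms by (simp_all add: commutator_def conjugate_def m_assoc inv_mult_group)

lemma commutator_one_iff:
  assumes "a \<in> carrier G" "b \<in> carrier G"
  shows "commutator a b = \<one> \<longleftrightarrow> a \<otimes> b = b \<otimes> a"
proof -
  have "commutator a b = (a \<otimes> b) \<otimes> inv (b \<otimes> a)"
    using assms by (simp add: commutator_def m_assoc inv_mult_group)
  then show ?thesis
    using assms inv_solve_right'[of \<one> "a \<otimes> b" "b \<otimes> a"] by auto
qed

lemma conjugate_eq_iff:
  assumes "a \<in> carrier G" "b \<in> carrier G"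
  shows "commutator a b = \<one> \<longleftrightarrow> conjugate a b = b"
  using assms inv_solve_right'[of \<one> "conjugate a b" b] by (auto simp: commutator_conjugate(1))

lemma conjugate_image_cancel:
  assumes "g \<in> carrier G" "B \<subseteq> carrier G"
  shows "conjugate (inv g) ` conjugate g ` B = B" "conjugate g ` conjugate (inv g) ` B = B"
  using assms by (auto simp: image_image subset_iff image_iff)

lemma normal_inD:
  assumes "normal_in N H"
  shows "subgroup N G" "N \<subseteq> H" "\<And>h n. h \<in> H \<Longrightarrow> n \<in> N \<Longrightarrow> conjugate h n \<in> N"
  using assms by (auto simp: normal_in_def)

lemma normal_in_self: "subgroup H G \<Longrightarrow> normal_in H H"
  by (simp add: normal_in_def conjugate_def subgroup.m_closed subgroup.m_inv_closed)

lemma normal_in_one: "subgroup H G \<Longrightarrow> normal_in {\<one>} H"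
  by (auto simp: normal_in_def triv_subgroup subgroup.one_closed subgroup.mem_carrier)

lemma normal_in_subset: "normal_in N H \<Longrightarrow> N \<subseteq> K \<Longrightarrow> K \<subseteq> H \<Longrightarrow> normal_in N K"
  by (auto simp: normal_in_def)

lemma normal_in_Int: "normal_in M H \<Longrightarrow> normal_in N H \<Longrightarrow> normal_in (M \<inter> N) H"
  by (auto simp: normal_in_def subgroups_Inter_pair)

lemma commutator_in_Int:
  assumes "normal_in U K" "normal_in V K" "K \<subseteq> carrier G" "u \<in> U" "v \<in> V"
  shows "commutator u v \<in> U \<inter> V"
proof -
  have "u \<in> carrier G" "v \<in> carrier G" "u \<in> K" "v \<in> K" using assms by (auto simp: normal_in_def)
  then show ?thesis
    using assms commutator_conjugate[of u v]
    by (metis IntI normal_inD(1,3) subgroup.m_closed subgroup.m_inv_closed)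
qed

lemma subgroup_conjugate:
  assumes "subgroup H G" "g \<in> carrier G"
  shows "subgroup (conjugate g ` H) G"
proof -
  have "conjugate g \<in> hom G G" using assms by (auto simp: hom_def conjugate_mult)
  then have "group_hom G G (conjugate g)"
    by (simp add: group_hom_def group_hom_axioms_def group_axioms)
  then show ?thesis using assms(1) by (rule group_hom.subgroup_img_is_subgroup)
qed

lemma normal_in_conjugate:
  assumes N: "normal_in N H" and H: "H \<subseteq> carrier G" and g: "g \<in> carrier G"
  shows "normal_in (conjugate g ` N) (conjugate g ` H)"
  unfolding normal_in_def
proof (intro conjI ballI)
  show "subgroup (conjugate g ` N) G" using N g by (simp add: normal_in_def subgroup_conjugate)
  show "conjugate g ` N \<subseteq> conjugate g ` H" using N by (auto simp: normal_in_def)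
  fix h n assume "h \<in> conjugate g ` H" "n \<in> conjugate g ` N"
  then obtain a b where ab: "a \<in> H" "h = conjugate g a" "b \<in> N" "n = conjugate g b" by blast
  have "a \<in> carrier G" "b \<in> carrier G" using ab H N by (auto simp: normal_in_def)
  then have "conjugate h n = conjugate g (conjugate a b)"
    using g ab by (simp add: conjugate_def m_assoc inv_mult_group)
  then show "conjugate h n \<in> conjugate g ` N" using N ab by (auto simp: normal_in_def)
qed

text \<open>Products and inverses stay inside because \<open>M\<close> is invariant under
  conjugation by \<open>H\<close>; conjugation by \<open>h\<close> moves the test from
  \<open>b\<close> to its conjugate by \<open>inv h\<close>, again in \<open>B\<close>. The set
  \<open>B\<close> may fail to be a subgroup, which permits a union of conjugates.\<close>

lemma normal_in_centraliser_mod: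
  assumes M: "normal_in M H" and H: "subgroup H G" and B: "B \<subseteq> H"
    and inv_B: "\<And>h b. h \<in> H \<Longrightarrow> b \<in> B \<Longrightarrow> conjugate h b \<in> B"
  shows "normal_in (centraliser_mod M H B) H"
  unfolding normal_in_def
proof (intro conjI ballI)
  note Hc = subgroup.mem_carrier[OF H]
  note MS = normal_inD[OF M]
  have Bc: "b \<in> carrier G" if "b \<in> B" for b using that B Hc by blast
  show sub: "centraliser_mod M H B \<subseteq> H" by (auto simp: centraliser_mod_def)
  show "subgroup (centraliser_mod M H B) G"
  proof (rule subgroupI)
    show "centraliser_mod M H B \<subseteq> carrier G" using sub Hc by blast
    have "commutator \<one> b = \<one>" if "b \<in> B" for b using Bc[OF that] by (simp add: commutator_def)
    then have "\<one> \<in> centraliser_mod M H B"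
      by (simp add: centraliser_mod_def subgroup.one_closed[OF H] subgroup.one_closed[OF MS(1)])
    then show "centraliser_mod M H B \<noteq> {}" by blast
    show "inv a \<in> centraliser_mod M H B" if "a \<in> centraliser_mod M H B" for a
      using that Bc Hc MS
      by (auto simp: centraliser_mod_def subgroup.m_inv_closed[OF H] commutator_inv_left
          intro!: subgroup.m_inv_closed[OF MS(1)])
    show "a \<otimes> b \<in> centraliser_mod M H B"
      if "a \<in> centraliser_mod M H B" "b \<in> centraliser_mod M H B" for a b
      using that Bc Hc MS
      by (auto simp: centraliser_mod_def subgroup.m_closed[OF H] commutator_mult_left
          intro!: subgroup.m_closed[OF MS(1)])
  qed
  fix h n assume h: "h \<in> H" and n: "n \<in> centraliser_mod M H B"
  then have nH: "n \<in> H" by (simp add: centraliser_mod_def)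
  have "commutator (conjugate h n) b \<in> M" if b: "b \<in> B" for b
  proof -
    have "inv h \<in> H" using h subgroup.m_inv_closed[OF H] by blast
    then have "conjugate (inv h) b \<in> B" using inv_B b by blast
    then have "conjugate h (commutator n (conjugate (inv h) b)) \<in> M"
      using n h MS(3) by (auto simp: centraliser_mod_def)
    then show ?thesis using h nH b Hc Bc by (simp add: conjugate_commutator)
  qed
  moreover have "conjugate h n \<in> H"
    using normal_inD(3)[OF normal_in_self[OF H]] h nH by blast
  ultimately show "conjugate h n \<in> centraliser_mod M H B"
    by (simp add: centraliser_mod_def)
qed

lemma centraliser_mod_symmetric:
  assumes "subgroup M G" "A \<subseteq> H" "B \<subseteq> H" "H \<subseteq> carrier G" "A \<subseteq> centraliser_mod M H B"
  shows "B \<subseteq> centraliser_mod M H A"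
proof
  fix b assume b: "b \<in> B"
  have "commutator b a \<in> M" if a: "a \<in> A" for a
  proof -
    have "commutator a b \<in> M" using a b assms(5) by (auto simp: centraliser_mod_def)
    moreover have "a \<in> carrier G" "b \<in> carrier G" using a b assms by auto
    ultimately show ?thesis
      using commutator_swap subgroup.m_inv_closed[OF assms(1)] by metis
  qed
  then show "b \<in> centraliser_mod M H A" using b assms(3) by (auto simp: centraliser_mod_def)
qed

lemma centraliser_mod_conjugate:
  assumes H: "H \<subseteq> carrier G" and B: "B \<subseteq> carrier G" and g: "g \<in> carrier G"
  shows "conjugate g ` centraliser_mod M H B \<subseteq>
    centraliser_mod (conjugate g ` M) (conjugate g ` H) (conjugate g ` B)"
proof -
  have "commutator (conjugate g a) (conjugate g b) = conjugate g (commutator a b)"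
    if "a \<in> H" "b \<in> B" for a b
    using that H B g by (simp add: conjugate_commutator subset_iff)
  then show ?thesis by (auto simp: centraliser_mod_def)
qed

section \<open>Quotients without abelian normal subgroups and the soluble radical\<close>

text \<open>The condition says that \<open>H/M\<close> has no nontrivial abelian normal subgroup; it suffices to
  test normal subgroups \<open>U\<close> that need not contain \<open>M\<close>.\<close>

definition semisimple_mod :: "'a set \<Rightarrow> 'a set \<Rightarrow> bool" where
  "semisimple_mod M H \<longleftrightarrow> normal_in M H \<and>
     (\<forall>U. normal_in U H \<longrightarrow> U \<subseteq> centraliser_mod M H U \<longrightarrow> U \<subseteq> M)"

lemma semisimple_mod_conjugate:
  assumes ss: "semisimple_mod M H" and H: "H \<subseteq> carrier G" and g: "g \<in> carrier G"
  shows "semisimple_mod (conjugate g ` M) (conjugate g ` H)"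
  unfolding semisimple_mod_def
proof (intro conjI allI impI)
  have M: "normal_in M H" using ss by (simp add: semisimple_mod_def)
  have Mc: "M \<subseteq> carrier G" using M H by (auto simp: normal_in_def)
  show "normal_in (conjugate g ` M) (conjugate g ` H)" using M H g by (rule normal_in_conjugate)
  fix U assume U: "normal_in U (conjugate g ` H)"
    and ab: "U \<subseteq> centraliser_mod (conjugate g ` M) (conjugate g ` H) U"
  have gH: "conjugate g ` H \<subseteq> carrier G" using H g by auto
  have Uc: "U \<subseteq> carrier G" using U gH by (auto simp: normal_in_def)
  have N: "normal_in (conjugate (inv g) ` U) H"
    using normal_in_conjugate[OF U gH, of "inv g"] g H by (simp add: conjugate_image_cancel)
  have "conjugate (inv g) ` U \<subseteq> centraliser_mod M H (conjugate (inv g) ` U)"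
    using ab centraliser_mod_conjugate[OF gH Uc, of "inv g" "conjugate g ` M"] g H Mc
    by (force simp: conjugate_image_cancel)
  then have "conjugate (inv g) ` U \<subseteq> M" using ss N by (simp add: semisimple_mod_def)
  then have "conjugate g ` conjugate (inv g) ` U \<subseteq> conjugate g ` M" by (rule image_mono)
  then show "U \<subseteq> conjugate g ` M" using g Uc by (simp add: conjugate_image_cancel)
qed

text \<open>Makes the family intersected in \<open>soluble_radical\<close> nonempty, so that the
  intersection stays inside \<open>H\<close>.\<close>

lemma semisimple_mod_self: "subgroup H G \<Longrightarrow> semisimple_mod H H"
  by (simp add: semisimple_mod_def normal_in_self) (simp add: normal_in_def)

text \<open>For a counterexample \<open>U\<close> of least order, any two conjugates under
  \<open>H\<close> commute modulo \<open>M\<close>. All of them therefore lie in one normal subgroup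
  of \<open>H\<close> that is abelian modulo \<open>M\<close>, against the hypothesis on
  \<open>H\<close>.\<close>

lemma semisimple_mod_normal_in:
  assumes ss: "semisimple_mod M H" and H: "subgroup H G" and fin: "finite H"
    and K: "normal_in K H" and MX: "M \<subseteq> K"
  shows "semisimple_mod M K"
proof (rule ccontr)
  have M: "normal_in M H" using ss by (simp add: semisimple_mod_def)
  have Hc: "H \<subseteq> carrier G" using H by (rule subgroup.subset)
  have XH: "K \<subseteq> H" using K by (simp add: normal_in_def)
  have MX': "normal_in M K" using M MX XH by (rule normal_in_subset)
  define P where "P U \<longleftrightarrow> normal_in U K \<and> U \<subseteq> centraliser_mod M K U \<and> \<not> U \<subseteq> M" for U
  assume "\<not> semisimple_mod M K"
  then have "\<exists>U. P U" using MX' by (auto simp: semisimple_mod_def P_def)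
  then obtain U where PU: "P U" and min: "\<And>V. P V \<Longrightarrow> card U \<le> card V"
    using ex_has_least_nat[of P _ card] by auto
  have UX: "normal_in U K" and UM: "\<not> U \<subseteq> M" and Uab: "U \<subseteq> centraliser_mod M K U"
    using PU by (auto simp: P_def)
  have UH: "U \<subseteq> H" using UX XH by (auto simp: normal_in_def)
  have finU: "finite U" using UH fin by (rule finite_subset)
  have conjX: "conjugate a ` K = K" if a: "a \<in> H" for a
  proof
    show "conjugate a ` K \<subseteq> K" using K a by (auto simp: normal_in_def)
    have "conjugate (inv a) ` K \<subseteq> K"
      using K subgroup.m_inv_closed[OF H a] by (auto simp: normal_in_def)
    then have "conjugate a ` conjugate (inv a) ` K \<subseteq> conjugate a ` K" by blast
    then show "K \<subseteq> conjugate a ` K" using a Hc XH by (simp add: conjugate_image_cancel subset_iff)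
  qed
  \<comment> \<open>By minimality \<open>U\<close> meets each conjugate either in itself or inside \<open>M\<close>.\<close>
  have key: "commutator u (conjugate a v) \<in> M" if a: "a \<in> H" and u: "u \<in> U" and v: "v \<in> U" for a u v
  proof -
    have ac: "a \<in> carrier G" using a Hc by blast
    have Xc: "K \<subseteq> carrier G" using XH Hc by blast
    have Ua: "normal_in (conjugate a ` U) K"
      using normal_in_conjugate[OF UX Xc ac] conjX[OF a] by simp
    let ?V = "U \<inter> conjugate a ` U"
    have VX: "normal_in ?V K" using UX Ua by (rule normal_in_Int)
    show ?thesis
    proof (cases "?V \<subseteq> M")
      case True
      then show ?thesis using commutator_in_Int[OF UX Ua Xc u] v by blast
    next
      case False
      have "?V \<subseteq> centraliser_mod M K ?V" using Uab by (auto simp: centraliser_mod_def)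
      then have "P ?V" using False VX by (simp add: P_def)
      then have "card U \<le> card ?V" by (rule min)
      then have "?V = U" using finU by (intro card_seteq) auto
      then have "U \<subseteq> conjugate a ` U" by blast
      moreover have "card (conjugate a ` U) \<le> card U" using finU by (rule card_image_le)
      ultimately have "U = conjugate a ` U" using finU by (intro card_seteq) auto
      then have "conjugate a v \<in> U" using v by blast
      then show ?thesis using Uab u by (auto simp: centraliser_mod_def)
    qed
  qed
  define Y where "Y = (\<Union>a\<in>H. conjugate a ` U)"
  have YH: "Y \<subseteq> H" using normal_inD(3)[OF normal_in_self[OF H]] UH by (auto simp: Y_def)
  have Y_inv: "conjugate h y \<in> Y" if h: "h \<in> H" and y: "y \<in> Y" for h y
  proof -
    obtain a u where "a \<in> H" "u \<in> U" "y = conjugate a u" using y by (auto simp: Y_def)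
    then have "conjugate h y = conjugate (h \<otimes> a) u"
      using h UH Hc by (simp add: conjugate_conjugate subset_iff)
    then show ?thesis using h \<open>a \<in> H\<close> \<open>u \<in> U\<close> subgroup.m_closed[OF H] by (auto simp: Y_def)
  qed
  have UY: "U \<subseteq> Y"
  proof
    fix u assume "u \<in> U"
    then show "u \<in> Y" using UH Hc subgroup.one_closed[OF H]
      by (auto simp: Y_def subset_iff intro!: bexI[of _ \<one>] image_eqI[of _ _ u])
  qed
  have Yab: "Y \<subseteq> centraliser_mod M H Y"
  proof
    fix y assume y: "y \<in> Y"
    have "commutator y z \<in> M" if z: "z \<in> Y" for z
    proof -
      obtain a u where a: "a \<in> H" "u \<in> U" "y = conjugate a u" using y by (auto simp: Y_def)
      obtain b v where b: "b \<in> H" "v \<in> U" "z = conjugate b v" using z by (auto simp: Y_def)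
      have c: "inv a \<otimes> b \<in> H" using a b H by (simp add: subgroup.m_closed subgroup.m_inv_closed)
      have car: "a \<in> carrier G" "b \<in> carrier G" "u \<in> carrier G" "v \<in> carrier G"
        using a b Hc UH by auto
      have "commutator y z = conjugate a (commutator u (conjugate (inv a \<otimes> b) v))"
        using car a b by (simp add: conjugate_commutator conjugate_conjugate)
      moreover have "\<dots> \<in> M" using key[OF c a(2) b(2)] a M by (auto simp: normal_in_def)
      ultimately show ?thesis by simp
    qed
    then show "y \<in> centraliser_mod M H Y" using y YH by (auto simp: centraliser_mod_def)
  qed
  define Z where "Z = centraliser_mod M H Y"
  have ZN: "normal_in Z H"
    unfolding Z_def using M H YH Y_inv by (rule normal_in_centraliser_mod)
  have ZH: "Z \<subseteq> H" using ZN by (rule normal_inD)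
  \<comment> \<open>The union \<open>Y\<close> is only a set. The centre \<open>W\<close> of its
    centraliser \<open>Z\<close>, taken modulo \<open>M\<close>, is a normal subgroup of
    \<open>H\<close> that is abelian modulo \<open>M\<close> and contains \<open>Y\<close>.\<close>
  define W where "W = centraliser_mod M H Z \<inter> Z"
  have WN: "normal_in W H"
    unfolding W_def
    using normal_in_centraliser_mod[OF M H ZH normal_inD(3)[OF ZN]] ZN by (rule normal_in_Int)
  have "W \<subseteq> centraliser_mod M H W" by (auto simp: W_def centraliser_mod_def)
  then have "W \<subseteq> M" using ss WN by (simp add: semisimple_mod_def)
  moreover have "Y \<subseteq> centraliser_mod M H Z"
    using centraliser_mod_symmetric[OF normal_inD(1)[OF M] ZH YH Hc] by (simp add: Z_def)
  then have "Y \<subseteq> W" using Yab by (simp add: W_def Z_def)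
  ultimately show False using UY UM by blast
qed

text \<open>A subgroup that is abelian modulo \<open>M\<close> is abelian modulo \<open>K\<close>,
  hence lies in \<open>K\<close>, where the second hypothesis applies to it.\<close>

lemma semisimple_mod_trans:
  assumes XH: "semisimple_mod K H" and MX: "semisimple_mod M K" and MH: "normal_in M H"
  shows "semisimple_mod M H"
  unfolding semisimple_mod_def
proof (intro conjI allI impI)
  show "normal_in M H" by fact
  fix U assume U: "normal_in U H" and ab: "U \<subseteq> centraliser_mod M H U"
  have sub: "M \<subseteq> K" "K \<subseteq> H" using XH MX by (auto simp: semisimple_mod_def normal_in_def)
  have "U \<subseteq> centraliser_mod K H U" using ab sub by (auto simp: centraliser_mod_def)
  then have UX: "U \<subseteq> K" using XH U by (simp add: semisimple_mod_def)
  then have "normal_in U K" "U \<subseteq> centraliser_mod M K U"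
    using U ab sub by (auto simp: normal_in_def centraliser_mod_def)
  then show "U \<subseteq> M" using MX by (simp add: semisimple_mod_def)
qed

text \<open>For finite \<open>H\<close> this is the usual largest soluble normal subgroup, obtained
  from above as the smallest \<open>M\<close> such that \<open>H/M\<close> has no nontrivial abelian
  normal subgroup; derived series are avoided.\<close>

definition soluble_radical :: "'a set \<Rightarrow> 'a set" where
  "soluble_radical H = \<Inter> {M. semisimple_mod M H}"

text \<open>A subgroup that is abelian modulo the intersection is abelian modulo each member of the
  family, so it lies in each of them.\<close>

lemma soluble_radical_semisimple:
  assumes H: "subgroup H G"
  shows "semisimple_mod (soluble_radical H) H"
  unfolding semisimple_mod_def
proof (intro conjI allI impI)
  let ?R = "soluble_radical H"
  have sub: "?R \<subseteq> H" using semisimple_mod_self[OF H] by (auto simp: soluble_radical_def)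
  have "subgroup ?R G"
    unfolding soluble_radical_def
    using semisimple_mod_self[OF H]
    by (intro subgroups_Inter) (auto simp: semisimple_mod_def normal_in_def)
  then show "normal_in ?R H" using sub
    by (auto simp: normal_in_def soluble_radical_def semisimple_mod_def)
  fix U assume U: "normal_in U H" and ab: "U \<subseteq> centraliser_mod ?R H U"
  show "U \<subseteq> ?R"
    unfolding soluble_radical_def
  proof (rule Inter_greatest)
    fix M assume "M \<in> {M. semisimple_mod M H}"
    then have M: "semisimple_mod M H" by simp
    then have "?R \<subseteq> M" by (auto simp: soluble_radical_def)
    then have "U \<subseteq> centraliser_mod M H U" using ab by (auto simp: centraliser_mod_def)
    then show "U \<subseteq> M" using M U by (simp add: semisimple_mod_def)
  qed
qed

text \<open>Common to the soluble radical and the socle: both are intersections of families that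
  conjugation permutes.\<close>

lemma Inter_conjugate:
  assumes x: "x \<in> \<Inter> {M. P M}" and g: "g \<in> carrier G"
    and P: "\<And>M. P M \<Longrightarrow> M \<subseteq> carrier G" "\<And>M. P M \<Longrightarrow> P (conjugate (inv g) ` M)"
  shows "conjugate g x \<in> \<Inter> {M. P M}"
proof (rule InterI)
  fix M assume "M \<in> {M. P M}"
  then have M: "P M" by simp
  then have "x \<in> conjugate (inv g) ` M" using x P(2) by blast
  then show "conjugate g x \<in> M" using g P(1)[OF M] by (auto simp: subset_iff)
qed

text \<open>The element \<open>g\<close> may lie outside \<open>H\<close>. This covers an edge
  reversal acting on an arc stabiliser.\<close>

lemma soluble_radical_conjugate:
  assumes H: "subgroup H G" and g: "g \<in> carrier G" "conjugate g ` H = H"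
    and x: "x \<in> soluble_radical H"
  shows "conjugate g x \<in> soluble_radical H"
  unfolding soluble_radical_def
proof (rule Inter_conjugate)
  show "x \<in> \<Inter> {M. semisimple_mod M H}" using x by (simp add: soluble_radical_def)
  have Hc: "H \<subseteq> carrier G" using H by (rule subgroup.subset)
  fix M assume M: "semisimple_mod M H"
  then show "M \<subseteq> carrier G" using Hc by (auto simp: semisimple_mod_def normal_in_def)
  have "conjugate (inv g) ` H = H" using conjugate_image_cancel(1)[OF g(1) Hc] g(2) by simp
  then show "semisimple_mod (conjugate (inv g) ` M) H"
    using semisimple_mod_conjugate[OF M Hc, of "inv g"] g by simp
qed (use g in simp)

lemma normal_in_conjugate_eq:
  assumes N: "normal_in N H" and H: "subgroup H G" and h: "h \<in> H"
  shows "conjugate h ` N = N"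
proof
  show "conjugate h ` N \<subseteq> N" using N h by (auto simp: normal_in_def)
  have "conjugate (inv h) ` N \<subseteq> N"
    using N subgroup.m_inv_closed[OF H h] by (auto simp: normal_in_def)
  then have "conjugate h ` conjugate (inv h) ` N \<subseteq> conjugate h ` N" by blast
  moreover have "N \<subseteq> carrier G" using N subgroup.subset[OF H] by (auto simp: normal_in_def)
  ultimately show "N \<subseteq> conjugate h ` N"
    using subgroup.mem_carrier[OF H h] by (simp add: conjugate_image_cancel)
qed

text \<open>The radical of \<open>H\<close> lies in \<open>K\<close>, and its property passes to the
  normal subgroup \<open>K\<close>. Conversely the radical of \<open>K\<close> is normal in
  \<open>H\<close>, being invariant under everything that normalises \<open>K\<close>, and
  \<open>semisimple_mod_trans\<close> lifts its property through \<open>K\<close>.\<close>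

lemma soluble_radical_normal_in:
  assumes H: "subgroup H G" and fin: "finite H" and K: "semisimple_mod K H"
  shows "soluble_radical K = soluble_radical H"
proof
  have KH: "normal_in K H" using K by (simp add: semisimple_mod_def)
  then have Ks: "subgroup K G" by (rule normal_inD)
  have RH: "semisimple_mod (soluble_radical H) H" using H by (rule soluble_radical_semisimple)
  have RK: "semisimple_mod (soluble_radical K) K" using Ks by (rule soluble_radical_semisimple)
  have "soluble_radical H \<subseteq> K" using K by (auto simp: soluble_radical_def)
  then have "semisimple_mod (soluble_radical H) K"
    using semisimple_mod_normal_in[OF RH H fin KH] by blast
  then show "soluble_radical K \<subseteq> soluble_radical H" by (auto simp: soluble_radical_def[of K])
  have "conjugate h x \<in> soluble_radical K" if "h \<in> H" "x \<in> soluble_radical K" for h x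
    using soluble_radical_conjugate[OF Ks _ normal_in_conjugate_eq[OF KH H]] that
      subgroup.mem_carrier[OF H] by blast
  then have "normal_in (soluble_radical K) H"
    using RK KH by (auto simp: semisimple_mod_def normal_in_def)
  then have "semisimple_mod (soluble_radical K) H"
    using semisimple_mod_trans[OF K RK] by blast
  then show "soluble_radical H \<subseteq> soluble_radical K" by (auto simp: soluble_radical_def[of H])
qed

section \<open>Essential subgroups and the socle\<close>

text \<open>For a finite group with trivial soluble radical, the subgroup defined as \<open>socle\<close> is the
  smallest normal subgroup with trivial centraliser, that is, the usual socle.\<close>

definition essential :: "'a set \<Rightarrow> 'a set \<Rightarrow> bool" where
  "essential M H \<longleftrightarrow> normal_in M H \<and> centraliser_mod {\<one>} H M \<subseteq> {\<one>}"

definition socle :: "'a set \<Rightarrow> 'a set" where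
  "socle H = \<Inter> {M. essential M H}"

lemma normal_in_centraliser:
  assumes "normal_in N H" "subgroup H G"
  shows "normal_in (centraliser_mod {\<one>} H N) H"
  using assms normal_inD(2,3)[OF assms(1)]
  by (intro normal_in_centraliser_mod normal_in_one) auto

lemma disjoint_normal_in_commute:
  assumes "normal_in U H" "normal_in V H" "subgroup H G" "U \<inter> V \<subseteq> {\<one>}"
  shows "U \<subseteq> centraliser_mod {\<one>} H V"
proof
  fix u assume u: "u \<in> U"
  have "commutator u v \<in> {\<one>}" if "v \<in> V" for v
    using commutator_in_Int[OF assms(1,2) subgroup.subset[OF assms(3)] u that] assms(4) by blast
  then show "u \<in> centraliser_mod {\<one>} H V"
    using u assms(1) by (auto simp: centraliser_mod_def normal_in_def)
qed

text \<open>The centre of \<open>N\<close> is an abelian normal subgroup of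
  \<open>H\<close>.\<close>

lemma semisimple_centre_trivial:
  assumes ss: "semisimple_mod {\<one>} H" and H: "subgroup H G" and N: "normal_in N H"
  shows "centraliser_mod {\<one>} H N \<inter> N \<subseteq> {\<one>}"
proof -
  let ?Z = "centraliser_mod {\<one>} H N \<inter> N"
  have "normal_in ?Z H" using normal_in_centraliser[OF N H] N by (rule normal_in_Int)
  moreover have "?Z \<subseteq> centraliser_mod {\<one>} H ?Z" by (auto simp: centraliser_mod_def)
  ultimately show ?thesis using ss by (simp add: semisimple_mod_def)
qed

text \<open>Let \<open>?V\<close> centralise \<open>M \<inter> N\<close>. Then
  \<open>?V \<inter> M\<close> meets \<open>N\<close> trivially, so it centralises \<open>N\<close>
  and is trivial; hence \<open>?V\<close> meets \<open>M\<close> trivially, centralises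
  \<open>M\<close> and is trivial as well.\<close>

lemma essential_Int:
  assumes ss: "semisimple_mod {\<one>} H" and H: "subgroup H G"
    and M: "essential M H" and N: "essential N H"
  shows "essential (M \<inter> N) H"
proof -
  let ?V = "centraliser_mod {\<one>} H (M \<inter> N)"
  have Mn: "normal_in M H" and Nn: "normal_in N H" using M N by (auto simp: essential_def)
  have I: "normal_in (M \<inter> N) H" using Mn Nn by (rule normal_in_Int)
  have V: "normal_in ?V H" using I H by (rule normal_in_centraliser)
  have VM: "normal_in (?V \<inter> M) H" using V Mn by (rule normal_in_Int)
  have "?V \<inter> M \<inter> N \<subseteq> {\<one>}" using semisimple_centre_trivial[OF ss H I] by (simp add: Int_assoc)
  then have "?V \<inter> M \<subseteq> {\<one>}"
    using disjoint_normal_in_commute[OF VM Nn H] N unfolding essential_def by (meson subset_trans)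
  then have "?V \<subseteq> {\<one>}"
    using disjoint_normal_in_commute[OF V Mn H] M unfolding essential_def by (meson subset_trans)
  then show ?thesis using I by (simp add: essential_def)
qed

text \<open>By \<open>essential_Int\<close> an essential subgroup of least order lies in every other
  one, so the intersection is attained.\<close>

lemma essential_socle:
  assumes ss: "semisimple_mod {\<one>} H" and H: "subgroup H G" and fin: "finite H"
  shows "essential (socle H) H"
proof -
  have "centraliser_mod {\<one>} H H \<subseteq> H" by (auto simp: centraliser_mod_def)
  then have "essential H H"
    using semisimple_centre_trivial[OF ss H normal_in_self[OF H]] normal_in_self[OF H]
    by (auto simp: essential_def)
  then obtain M where M: "essential M H" and min: "\<And>N. essential N H \<Longrightarrow> card M \<le> card N"
    using ex_has_least_nat[of "\<lambda>M. essential M H" _ card] by auto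
  have "finite M" using M fin by (auto simp: essential_def normal_in_def intro: finite_subset)
  have "M \<subseteq> N" if N: "essential N H" for N
  proof -
    have "M \<inter> N = M"
      using min[OF essential_Int[OF ss H M N]] \<open>finite M\<close> by (intro card_seteq) auto
    then show ?thesis by blast
  qed
  then have "socle H = M" using M by (auto simp: socle_def)
  then show ?thesis using M by simp
qed

lemma essential_conjugate:
  assumes M: "essential M H" and H: "H \<subseteq> carrier G" and g: "g \<in> carrier G"
  shows "essential (conjugate g ` M) (conjugate g ` H)"
  unfolding essential_def
proof
  have Mn: "normal_in M H" using M by (simp add: essential_def)
  then have Mc: "M \<subseteq> carrier G" using H by (auto simp: normal_in_def)
  show "normal_in (conjugate g ` M) (conjugate g ` H)" using Mn H g by (rule normal_in_conjugate)
  let ?C = "centraliser_mod {\<one>} (conjugate g ` H) (conjugate g ` M)"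
  have gc: "conjugate g ` H \<subseteq> carrier G" "conjugate g ` M \<subseteq> carrier G" using H Mc g by auto
  have Cc: "?C \<subseteq> carrier G" using gc by (auto simp: centraliser_mod_def)
  have "conjugate (inv g) ` ?C \<subseteq> centraliser_mod {\<one>} H M"
    using centraliser_mod_conjugate[OF gc, of "inv g" "{\<one>}"] g H Mc
    by (simp add: conjugate_image_cancel)
  then have "conjugate (inv g) ` ?C \<subseteq> {\<one>}"
    using M unfolding essential_def by (meson subset_trans)
  then have "conjugate g ` conjugate (inv g) ` ?C \<subseteq> conjugate g ` {\<one>}" by (rule image_mono)
  then show "?C \<subseteq> {\<one>}" using g Cc by (simp add: conjugate_image_cancel)
qed

lemma socle_conjugate:
  assumes H: "subgroup H G" and g: "g \<in> carrier G" "conjugate g ` H = H"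
    and x: "x \<in> socle H"
  shows "conjugate g x \<in> socle H"
  unfolding socle_def
proof (rule Inter_conjugate)
  show "x \<in> \<Inter> {M. essential M H}" using x by (simp add: socle_def)
  have Hc: "H \<subseteq> carrier G" using H by (rule subgroup.subset)
  fix M assume M: "essential M H"
  then show "M \<subseteq> carrier G" using Hc by (auto simp: essential_def normal_in_def)
  have "conjugate (inv g) ` H = H" using conjugate_image_cancel(1)[OF g(1) Hc] g(2) by simp
  then show "essential (conjugate (inv g) ` M) H"
    using essential_conjugate[OF M Hc, of "inv g"] g by simp
qed (use g in simp)

text \<open>The socle of \<open>H\<close> lies in \<open>K\<close> and has trivial centraliser there
  too. Conversely the centraliser in \<open>H\<close> of the socle of \<open>K\<close> meets
  \<open>K\<close> trivially, so it centralises the essential subgroup \<open>K\<close> and is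
  trivial.\<close>

lemma socle_normal_in:
  assumes ss: "semisimple_mod {\<one>} H" and H: "subgroup H G" and fin: "finite H"
    and K: "essential K H"
  shows "socle K = socle H"
proof
  have KH: "normal_in K H" and cK: "centraliser_mod {\<one>} H K \<subseteq> {\<one>}"
    using K by (auto simp: essential_def)
  have Ks: "subgroup K G" and KsubH: "K \<subseteq> H" using KH by (auto simp: normal_in_def)
  have ssK: "semisimple_mod {\<one>} K"
    using semisimple_mod_normal_in[OF ss H fin KH] subgroup.one_closed[OF Ks] by simp
  have eH: "essential (socle H) H" using ss H fin by (rule essential_socle)
  have eK: "essential (socle K) K"
    using ssK Ks finite_subset[OF KsubH fin] by (rule essential_socle)
  have sHK: "socle H \<subseteq> K" using K by (auto simp: socle_def)
  have "normal_in (socle H) K" using eH sHK KsubH by (auto simp: essential_def normal_in_def)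
  moreover have "centraliser_mod {\<one>} K (socle H) \<subseteq> {\<one>}"
    using eH KsubH by (auto simp: essential_def centraliser_mod_def)
  ultimately show "socle K \<subseteq> socle H" by (auto simp: socle_def[of K] essential_def)
  have "conjugate h x \<in> socle K" if "h \<in> H" "x \<in> socle K" for h x
    using socle_conjugate[OF Ks _ normal_in_conjugate_eq[OF KH H]] that
      subgroup.mem_carrier[OF H] by blast
  then have sK: "normal_in (socle K) H" using eK KsubH by (auto simp: essential_def normal_in_def)
  let ?V = "centraliser_mod {\<one>} H (socle K)"
  have V: "normal_in ?V H" using sK H by (rule normal_in_centraliser)
  have "?V \<inter> K \<subseteq> {\<one>}" using eK by (auto simp: essential_def centraliser_mod_def)
  then have "?V \<subseteq> {\<one>}" using disjoint_normal_in_commute[OF V KH H] cK by blast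
  then have "essential (socle K) H" using sK by (simp add: essential_def)
  then show "socle H \<subseteq> socle K" by (auto simp: socle_def[of H])
qed

section \<open>The Thompson-Wielandt argument in an abstract group\<close>

text \<open>\<open>P\<close> stands for a vertex stabiliser, \<open>A\<close> for an arc stabiliser,
  \<open>K\<close> for the kernel on the neighbourhood and \<open>t\<close> for an edge reversal.
  The assumption \<open>core\<close> is applied to the radical of \<open>A\<close>, and then to its
  socle or to the edge kernel itself.\<close>

theorem edge_kernel_trivial:
  assumes P: "subgroup P G" "finite P" and A: "subgroup A G" "A \<subseteq> P"
    and K: "normal_in K P" "K \<subseteq> A"
    and t: "t \<in> carrier G" "conjugate t ` A = A" "t \<otimes> t \<in> A"
    and core: "\<And>N. subgroup N G \<Longrightarrow> N \<subseteq> A \<Longrightarrow>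
      (\<And>g n. g \<in> insert t P \<Longrightarrow> n \<in> N \<Longrightarrow> conjugate g n \<in> N) \<Longrightarrow> N \<subseteq> {\<one>}"
    and ss: "semisimple_mod K A"
    and dich: "\<And>C. normal_in C P \<Longrightarrow> C \<inter> A \<subseteq> K \<or> (\<forall>p\<in>P. \<exists>c\<in>C. \<exists>a\<in>A. p = c \<otimes> a)"
  shows "K \<inter> conjugate t ` K \<subseteq> {\<one>}"
proof -
  note Pc = subgroup.subset[OF P(1)]
  have finA: "finite A" using A(2) P(2) by (rule finite_subset)
  have KA: "normal_in K A" using ss by (simp add: semisimple_mod_def)
  have Ks: "subgroup K G" using KA by (rule normal_inD)
  have Kc: "K \<subseteq> carrier G" using Ks by (rule subgroup.subset)
  have radA: "semisimple_mod (soluble_radical A) A" using A(1) by (rule soluble_radical_semisimple)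
  have rad_eq: "soluble_radical K = soluble_radical A"
    using A(1) finA ss by (rule soluble_radical_normal_in)
  \<comment> \<open>The swap \<open>t\<close> normalises \<open>A\<close>, hence its radical;
    elements of \<open>P\<close> normalise \<open>K\<close>, and \<open>K\<close> has the same
    radical as \<open>A\<close>.\<close>
  have "soluble_radical A \<subseteq> {\<one>}"
  proof (rule core)
    show "subgroup (soluble_radical A) G" "soluble_radical A \<subseteq> A"
      using radA by (auto simp: semisimple_mod_def normal_in_def)
    fix g n assume g: "g \<in> insert t P" and n: "n \<in> soluble_radical A"
    show "conjugate g n \<in> soluble_radical A"
    proof (cases "g = t")
      case True
      then show ?thesis using soluble_radical_conjugate[OF A(1) t(1,2) n] by simp
    next
      case False
      then have "g \<in> P" using g by simp
      then show ?thesis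
        using soluble_radical_conjugate[OF Ks _ normal_in_conjugate_eq[OF K(1) P(1)], of g n] n Pc
        by (auto simp: rad_eq)
    qed
  qed
  moreover have "\<one> \<in> soluble_radical A"
    using radA by (auto simp: semisimple_mod_def normal_in_def subgroup.one_closed)
  ultimately have ssA: "semisimple_mod {\<one>} A" using radA by (metis subset_singletonD empty_iff)
  let ?C = "centraliser_mod {\<one>} P K"
  let ?D = "K \<inter> conjugate t ` K"
  have C: "normal_in ?C P" using K(1) P(1) by (rule normal_in_centraliser)
  show ?thesis
  proof (cases "?C \<inter> A \<subseteq> K")
    case True
    \<comment> \<open>The centraliser of \<open>K\<close> in \<open>A\<close> lies in
      \<open>K\<close>, so it is the centre of \<open>K\<close>, an abelian normal subgroup of
      \<open>A\<close>.\<close>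
    have "centraliser_mod {\<one>} A K \<subseteq> ?C \<inter> A" using A(2) by (auto simp: centraliser_mod_def)
    then have "centraliser_mod {\<one>} A K \<subseteq> {\<one>}"
      using semisimple_centre_trivial[OF ssA A(1) KA] True by blast
    then have eK: "essential K A" using KA by (simp add: essential_def)
    have soc_eq: "socle K = socle A" using ssA A(1) finA eK by (rule socle_normal_in)
    have eA: "essential (socle A) A" using ssA A(1) finA by (rule essential_socle)
    have "socle A \<subseteq> {\<one>}"
    proof (rule core)
      show "subgroup (socle A) G" "socle A \<subseteq> A" using eA by (auto simp: essential_def normal_in_def)
      fix g n assume g: "g \<in> insert t P" and n: "n \<in> socle A"
      show "conjugate g n \<in> socle A"
      proof (cases "g = t")
        case True
        then show ?thesis using socle_conjugate[OF A(1) t(1,2) n] by simp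
      next
        case False
        then have "g \<in> P" using g by simp
        then show ?thesis
          using socle_conjugate[OF Ks _ normal_in_conjugate_eq[OF K(1) P(1)], of g n] n Pc
          by (auto simp: soc_eq)
      qed
    qed
    \<comment> \<open>All of \<open>A\<close> centralises the trivial socle, yet an essential
      subgroup has trivial centraliser; so \<open>A\<close> is trivial.\<close>
    then have "A \<subseteq> centraliser_mod {\<one>} A (socle A)"
      using subgroup.subset[OF A(1)] by (auto simp: centraliser_mod_def commutator_one_iff subset_iff)
    then have "A \<subseteq> {\<one>}" using eA by (auto simp: essential_def)
    then show ?thesis using K(2) by blast
  next
    case False
    \<comment> \<open>Now \<open>P\<close> is the product of \<open>?C\<close> and \<open>A\<close>.
      As \<open>?C\<close> centralises \<open>K\<close>, conjugation by \<open>P\<close> moves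
      elements of \<open>?D\<close> only as \<open>A\<close> does, and \<open>A\<close> normalises
      \<open>?D\<close>.\<close>
    then have PCA: "\<exists>c\<in>?C. \<exists>a\<in>A. p = c \<otimes> a" if "p \<in> P" for p
      using dich[OF C] that by blast
    have tK: "normal_in (conjugate t ` K) A"
      using normal_in_conjugate[OF KA subgroup.subset[OF A(1)] t(1)] t(2) by simp
    have D: "normal_in ?D A" using KA tK by (rule normal_in_Int)
    show ?thesis
    proof (rule core)
      show "subgroup ?D G" "?D \<subseteq> A" using D by (auto simp: normal_in_def)
      fix g n assume g: "g \<in> insert t P" and n: "n \<in> ?D"
      have nc: "n \<in> carrier G" using n Kc by blast
      show "conjugate g n \<in> ?D"
      proof (cases "g = t")
        case True
        obtain k where k: "k \<in> K" "n = conjugate t k" using n by blast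
        \<comment> \<open>Since \<open>t \<otimes> t\<close> lies in \<open>A\<close>, it normalises
          \<open>K\<close>; so \<open>t\<close> sends its conjugate of \<open>K\<close> back into
          \<open>K\<close>.\<close>
        have "conjugate t n = conjugate (t \<otimes> t) k" using k t(1) Kc by (auto simp: conjugate_conjugate)
        then have "conjugate t n \<in> K" using k(1) normal_inD(3)[OF KA t(3)] by simp
        then show ?thesis using True n by blast
      next
        case False
        then obtain c a where c: "c \<in> ?C" and a: "a \<in> A" and gca: "g = c \<otimes> a"
          using PCA g by blast
        have car: "c \<in> carrier G" "a \<in> carrier G"
          using c a Pc A(2) by (auto simp: centraliser_mod_def)
        have an: "conjugate a n \<in> ?D" using D a n by (auto simp: normal_in_def)
        then have "commutator c (conjugate a n) = \<one>" using c by (auto simp: centraliser_mod_def)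
        then have "conjugate c (conjugate a n) = conjugate a n"
          using conjugate_eq_iff car nc by simp
        then show ?thesis using an car nc by (simp add: gca conjugate_conjugate)
      qed
    qed
  qed
qed

end

section \<open>Comparison with normality in the library, and products of subgroups\<close>

lemma (in group) normal_in_iff:
  assumes H: "subgroup H G"
  shows "N \<lhd> G\<lparr>carrier := H\<rparr> \<longleftrightarrow> normal_in N H"
proof -
  interpret H: group "G\<lparr>carrier := H\<rparr>" using H by (rule subgroup_imp_group)
  have "subgroup N (G\<lparr>carrier := H\<rparr>) \<longleftrightarrow> subgroup N G \<and> N \<subseteq> H"
    using incl_subgroup[OF H] subgroup_incl[OF _ H] subgroup.subset[of N "G\<lparr>carrier := H\<rparr>"] by auto
  then show ?thesis
    by (auto simp: H.normal_inv_iff normal_in_def conjugate_def m_inv_consistent[OF H])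
qed

lemma (in group) commutator_in_normal:
  assumes N: "normal_in N H" and H: "subgroup H G" and n: "n \<in> N" and h: "h \<in> H"
  shows "commutator n h \<in> N" "commutator h n \<in> N"
  using commutator_in_Int[OF N normal_in_self[OF H] subgroup.subset[OF H] n h]
    commutator_in_Int[OF normal_in_self[OF H] N subgroup.subset[OF H] h n] by auto

text \<open>\<open>H\<close> is the product of \<open>N\<close> and \<open>A\<close>: elements of
  \<open>A\<close> normalise both \<open>U\<close> and \<open>N\<close>, and conjugation by an
  element of \<open>N\<close> changes an element of \<open>U\<close> only by a factor from
  \<open>N\<close>.\<close>

lemma (in group) normal_in_product:
  assumes H: "subgroup H G" and N: "normal_in N H" and A: "A \<subseteq> H" and U: "normal_in U A"
    and H_eq: "\<And>h. h \<in> H \<Longrightarrow> \<exists>n\<in>N. \<exists>a\<in>A. h = n \<otimes> a"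
  shows "normal_in {u \<otimes> n |u n. u \<in> U \<and> n \<in> N} H"
  unfolding normal_in_def
proof (intro conjI ballI)
  let ?P = "{u \<otimes> n |u n. u \<in> U \<and> n \<in> N}"
  have Us: "subgroup U G" and Ns: "subgroup N G" using U N by (auto simp: normal_in_def)
  have UH: "U \<subseteq> H" and NH: "N \<subseteq> H" using U A N by (auto simp: normal_in_def)
  have Hc: "x \<in> carrier G" if "x \<in> H" for x using that H by (rule subgroup.mem_carrier[rotated])
  have Uc: "x \<in> carrier G" if "x \<in> U" for x using that UH Hc by blast
  have Nc: "x \<in> carrier G" if "x \<in> N" for x using that NH Hc by blast
  show "?P \<subseteq> H" using UH NH subgroup.m_closed[OF H] by blast
  show "subgroup ?P G"
  proof (rule subgroupI)
    show "?P \<subseteq> carrier G" using Uc Nc by auto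
    show "?P \<noteq> {}" using subgroup.one_closed[OF Us] subgroup.one_closed[OF Ns] by blast
    fix x assume "x \<in> ?P"
    then obtain u n where x: "x = u \<otimes> n" "u \<in> U" "n \<in> N" by blast
    have "inv x = inv u \<otimes> conjugate u (inv n)"
      using x Uc Nc by (simp add: conjugate_def inv_mult_group m_assoc)
    moreover have "conjugate u (inv n) \<in> N"
      using normal_inD(3)[OF N] subgroup.m_inv_closed[OF Ns x(3)] x(2) UH by blast
    ultimately show "inv x \<in> ?P" using x subgroup.m_inv_closed[OF Us] by blast
    fix y assume "y \<in> ?P"
    then obtain v m where y: "y = v \<otimes> m" "v \<in> U" "m \<in> N" by blast
    have "x \<otimes> y = (u \<otimes> v) \<otimes> (conjugate (inv v) n \<otimes> m)"
      using x y Uc Nc by (simp add: conjugate_def m_assoc)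
    moreover have "conjugate (inv v) n \<in> N"
      using normal_inD(3)[OF N] subgroup.m_inv_closed[OF Us y(2)] x(3) UH by blast
    ultimately show "x \<otimes> y \<in> ?P"
      using x y subgroup.m_closed[OF Us] subgroup.m_closed[OF Ns] by blast
  qed
  fix h x assume h: "h \<in> H" and "x \<in> ?P"
  then obtain u n where x: "x = u \<otimes> n" "u \<in> U" "n \<in> N" by blast
  obtain m a where m: "m \<in> N" and a: "a \<in> A" and hma: "h = m \<otimes> a" using H_eq[OF h] by blast
  have ac: "a \<in> carrier G" using a A Hc by blast
  let ?v = "conjugate a u"
  have v: "?v \<in> U" using U a x by (auto simp: normal_in_def)
  \<comment> \<open>Conjugation by \<open>a\<close> turns \<open>u \<otimes> n\<close> into
    \<open>?v \<otimes> conjugate a n\<close>; moving \<open>m\<close> to the right past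
    \<open>?v\<close> replaces it by its conjugate under \<open>inv ?v\<close>, again in
    \<open>N\<close>.\<close>
  have "conjugate h x = ?v \<otimes> (conjugate (inv ?v) m \<otimes> (conjugate a n \<otimes> inv m))"
    using x m ac Uc Nc by (simp add: hma conjugate_def inv_mult_group m_assoc)
  moreover have "conjugate (inv ?v) m \<in> N" "conjugate a n \<in> N" "inv m \<in> N"
    using normal_inD(3)[OF N] subgroup.m_inv_closed[OF Us v] subgroup.m_inv_closed[OF Ns m]
      m x(3) a UH A by blast+
  ultimately show "conjugate h x \<in> ?P"
    using v subgroup.m_closed[OF Ns] by blast
qed

section \<open>Semiprimitive groups with two plinths\<close>

interpretation Sym: group "BijGroup S" for S
  by (rule group_BijGroup)

lemma carrier_BijGroup [simp]: "carrier (BijGroup S) = Bij S"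
  by (simp add: BijGroup_def)

lemmas BijGroup_closed [simp] =
  Sym.one_closed[unfolded carrier_BijGroup] Sym.m_closed[unfolded carrier_BijGroup]
  Sym.inv_closed[unfolded carrier_BijGroup] Sym.conjugate_closed[unfolded carrier_BijGroup]
  Sym.commutator_closed[unfolded carrier_BijGroup]

lemma one_BijGroup_apply [simp]: "x \<in> S \<Longrightarrow> \<one>\<^bsub>BijGroup S\<^esub> x = x"
  by (simp add: BijGroup_def)

lemma mult_BijGroup_apply [simp]:
  "g \<in> Bij S \<Longrightarrow> h \<in> Bij S \<Longrightarrow> x \<in> S \<Longrightarrow> (g \<otimes>\<^bsub>BijGroup S\<^esub> h) x = g (h x)"
  by (simp add: BijGroup_mult compose_eq)

lemma Bij_mem: "g \<in> Bij S \<Longrightarrow> x \<in> S \<Longrightarrow> g x \<in> S"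
  using Bij_imp_funcset by blast

lemma inv_BijGroup_apply:
  assumes "g \<in> Bij S" "x \<in> S"
  shows inv_BijGroup_apply_left [simp]: "(inv\<^bsub>BijGroup S\<^esub> g) (g x) = x"
    and inv_BijGroup_apply_right: "g ((inv\<^bsub>BijGroup S\<^esub> g) x) = x"
proof -
  have "(inv\<^bsub>BijGroup S\<^esub> g) (g x) = (inv\<^bsub>BijGroup S\<^esub> g \<otimes>\<^bsub>BijGroup S\<^esub> g) x"
    using assms by (intro mult_BijGroup_apply[symmetric]) simp_all
  also have "\<dots> = x" using assms by (subst Sym.l_inv) simp_all
  finally show "(inv\<^bsub>BijGroup S\<^esub> g) (g x) = x" .
  have "g ((inv\<^bsub>BijGroup S\<^esub> g) x) = (g \<otimes>\<^bsub>BijGroup S\<^esub> inv\<^bsub>BijGroup S\<^esub> g) x"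
    using assms by (intro mult_BijGroup_apply[symmetric]) simp_all
  also have "\<dots> = x" using assms by (subst Sym.r_inv) simp_all
  finally show "g ((inv\<^bsub>BijGroup S\<^esub> g) x) = x" .
qed

lemma Bij_eqI: "g \<in> Bij S \<Longrightarrow> h \<in> Bij S \<Longrightarrow> (\<And>x. x \<in> S \<Longrightarrow> g x = h x) \<Longrightarrow> g = h"
  by (rule extensionalityI) (auto simp: Bij_def)

lemma perm_group_Bij: "perm_group S H \<Longrightarrow> g \<in> H \<Longrightarrow> g \<in> Bij S"
  using subgroup.mem_carrier by fastforce

lemma semiregular_iff:
  "semiregular S N \<longleftrightarrow> (\<forall>x\<in>S. {g \<in> N. g x = x} = {\<one>\<^bsub>BijGroup S\<^esub>})"
  by (simp add: semiregular_def point_stabiliser_eq)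

lemma semiprimitiveD:
  assumes "semiprimitive S L" "perm_group S L" "Sym.normal_in S N L" "\<not> transitive S N"
  shows "semiregular S N"
  using assms by (auto simp: semiprimitive_def Sym.normal_in_iff)

lemma plinthD:
  assumes "plinth S L K" "perm_group S L"
  shows "Sym.normal_in S K L" "transitive S K"
    "\<And>M. Sym.normal_in S M L \<Longrightarrow> M \<subseteq> K \<Longrightarrow> transitive S M \<Longrightarrow> M = K"
  using assms unfolding plinth_def Sym.normal_in_iff[OF assms(2)] by auto

lemma perm_group_stabiliser:
  assumes L: "perm_group S L" and w: "w \<in> S"
  shows "perm_group S {g \<in> L. g w = w}"
proof (rule Sym.subgroupI)
  show "{g \<in> L. g w = w} \<subseteq> carrier (BijGroup S)" using perm_group_Bij[OF L] by auto
  show "{g \<in> L. g w = w} \<noteq> {}" using subgroup.one_closed[OF L] w by force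
  fix g assume g: "g \<in> {g \<in> L. g w = w}"
  then have "(inv\<^bsub>BijGroup S\<^esub> g) w = w"
    using inv_BijGroup_apply(1)[of g S w] perm_group_Bij[OF L] w by auto
  then show "inv\<^bsub>BijGroup S\<^esub> g \<in> {g \<in> L. g w = w}"
    using g subgroup.m_inv_closed[OF L] by auto
  fix h assume "h \<in> {g \<in> L. g w = w}"
  then show "g \<otimes>\<^bsub>BijGroup S\<^esub> h \<in> {g \<in> L. g w = w}"
    using g w perm_group_Bij[OF L] subgroup.m_closed[OF L] by auto
qed

text \<open>The subgroup is the kernel of the action of \<open>L\<close> on the set of
  \<open>N\<close>-orbits, expressed pointwise so that no set of orbits has to be formed.\<close>

lemma orbit_kernel_normal_in:
  assumes L: "perm_group S L" and N: "Sym.normal_in S N L"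
  shows "Sym.normal_in S {g \<in> L. \<forall>s\<in>S. \<exists>n\<in>N. g s = n s} L" (is "Sym.normal_in S ?Q L")
  unfolding Sym.normal_in_def
proof (intro conjI ballI)
  note LB = perm_group_Bij[OF L]
  have Ns: "perm_group S N" and NL: "N \<subseteq> L" using N by (auto simp: Sym.normal_in_def)
  have NB: "n \<in> Bij S" if "n \<in> N" for n using that Ns by (rule perm_group_Bij[rotated])
  show "?Q \<subseteq> L" by blast
  show "perm_group S ?Q"
  proof (rule Sym.subgroupI)
    show "?Q \<subseteq> carrier (BijGroup S)" using LB by auto
    show "?Q \<noteq> {}" using subgroup.one_closed[OF L] subgroup.one_closed[OF Ns] by blast
    fix g assume g: "g \<in> ?Q"
    then have gB: "g \<in> Bij S" using LB by blast
    have "\<exists>n\<in>N. (inv\<^bsub>BijGroup S\<^esub> g) s = n s" if s: "s \<in> S" for s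
    proof -
      let ?s = "(inv\<^bsub>BijGroup S\<^esub> g) s"
      have s': "?s \<in> S" using Bij_mem[OF BijGroup_closed(3)[OF gB] s] .
      then obtain n where n: "n \<in> N" "g ?s = n ?s" using g by blast
      then have "n ?s = s" using gB s by (simp add: inv_BijGroup_apply_right)
      then have "(inv\<^bsub>BijGroup S\<^esub> n) s = ?s" using inv_BijGroup_apply(1)[OF NB[OF n(1)] s'] by simp
      then show ?thesis using n(1) subgroup.m_inv_closed[OF Ns] by metis
    qed
    then show "inv\<^bsub>BijGroup S\<^esub> g \<in> ?Q" using g subgroup.m_inv_closed[OF L] by blast
    fix h assume h: "h \<in> ?Q"
    then have hB: "h \<in> Bij S" using LB by blast
    have "\<exists>n\<in>N. (g \<otimes>\<^bsub>BijGroup S\<^esub> h) s = n s" if s: "s \<in> S" for s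
    proof -
      obtain n where n: "n \<in> N" "h s = n s" using h s by blast
      obtain m where m: "m \<in> N" "g (h s) = m (h s)" using g Bij_mem[OF hB s] by blast
      have "(g \<otimes>\<^bsub>BijGroup S\<^esub> h) s = (m \<otimes>\<^bsub>BijGroup S\<^esub> n) s"
        using n m s gB hB NB by simp
      then show ?thesis using n m subgroup.m_closed[OF Ns] by metis
    qed
    then show "g \<otimes>\<^bsub>BijGroup S\<^esub> h \<in> ?Q" using g h subgroup.m_closed[OF L] by blast
  qed
  fix h g assume h: "h \<in> L" and g: "g \<in> ?Q"
  have hB: "h \<in> Bij S" and gB: "g \<in> Bij S" using h g LB by auto
  have "\<exists>n\<in>N. (Sym.conjugate S h g) s = n s" if s: "s \<in> S" for s
  proof -
    have s': "(inv\<^bsub>BijGroup S\<^esub> h) s \<in> S" using Bij_mem[OF BijGroup_closed(3)[OF hB] s] .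
    then obtain n where n: "n \<in> N" "g ((inv\<^bsub>BijGroup S\<^esub> h) s) = n ((inv\<^bsub>BijGroup S\<^esub> h) s)"
      using g by blast
    have ap: "Sym.conjugate S h k s = h (k ((inv\<^bsub>BijGroup S\<^esub> h) s))" if k: "k \<in> Bij S" for k
    proof -
      have "h \<otimes>\<^bsub>BijGroup S\<^esub> k \<in> Bij S" using Sym.m_closed[of h S k] hB k by simp
      then show ?thesis using hB k s s' by (simp add: Sym.conjugate_def)
    qed
    have "Sym.conjugate S h g s = Sym.conjugate S h n s"
      using ap[OF gB] ap[OF NB[OF n(1)]] n(2) by simp
    moreover have "Sym.conjugate S h n \<in> N" using N h n by (auto simp: Sym.normal_in_def)
    ultimately show ?thesis by metis
  qed
  moreover have "Sym.conjugate S h g \<in> L"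
    using Sym.normal_inD(3)[OF Sym.normal_in_self[OF L]] h g by blast
  ultimately show "Sym.conjugate S h g \<in> ?Q" by blast
qed

text \<open>The kernel \<open>?Q\<close> has the same orbits as \<open>N\<close>, so it is
  intransitive and hence semiregular. An element of \<open>N\<close> that agrees with
  \<open>g\<close> at one point lies in \<open>?Q\<close> too and therefore equals
  \<open>g\<close>.\<close>

lemma semiprimitive_orbit_kernel:
  assumes sp: "semiprimitive S L" and L: "perm_group S L"
    and N: "Sym.normal_in S N L" "\<not> transitive S N"
    and S: "S \<noteq> {}" and g: "g \<in> L" "\<And>s. s \<in> S \<Longrightarrow> \<exists>n\<in>N. g s = n s"
  shows "g \<in> N"
proof -
  let ?Q = "{g \<in> L. \<forall>s\<in>S. \<exists>n\<in>N. g s = n s}"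
  have Q: "Sym.normal_in S ?Q L" using L N(1) by (rule orbit_kernel_normal_in)
  have Qs: "perm_group S ?Q" and Ns: "perm_group S N" and NL: "N \<subseteq> L"
    using Q N by (auto simp: Sym.normal_in_def)
  have "\<not> transitive S ?Q"
  proof
    assume "transitive S ?Q"
    then have "\<forall>x\<in>S. \<forall>y\<in>S. \<exists>n\<in>N. n x = y"
      unfolding transitive_iff[OF Qs] by fastforce
    then show False using N(2) by (simp add: transitive_iff[OF Ns])
  qed
  with sp L Q have sr: "semiregular S ?Q" by (rule semiprimitiveD)
  obtain s where s: "s \<in> S" using S by blast
  obtain n where n: "n \<in> N" "g s = n s" using g(2)[OF s] by blast
  have nQ: "n \<in> ?Q" using n NL by blast
  have gQ: "g \<in> ?Q" using g by blast
  have B: "g \<in> Bij S" "n \<in> Bij S" using perm_group_Bij[OF Qs] gQ nQ by auto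
  let ?h = "inv\<^bsub>BijGroup S\<^esub> n \<otimes>\<^bsub>BijGroup S\<^esub> g"
  have "?h \<in> ?Q" using subgroup.m_closed[OF Qs subgroup.m_inv_closed[OF Qs nQ] gQ] .
  moreover have "?h s = s" using n s B by simp
  ultimately have "?h = \<one>\<^bsub>BijGroup S\<^esub>" using sr s unfolding semiregular_iff by blast
  then have "g = n" using B Sym.inv_solve_left'[of "\<one>\<^bsub>BijGroup S\<^esub>" S n g] by simp
  then show ?thesis using n by simp
qed

text \<open>As \<open>g\<close> fixes \<open>w\<close>, it moves \<open>k w\<close> as the
  commutator of \<open>g\<close> and \<open>k\<close> does. Since \<open>T\<close> is transitive,
  \<open>g\<close> preserves every orbit of \<open>N\<close>.\<close>

lemma semiprimitive_commutator_kernel: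
  assumes sp: "semiprimitive S L" and L: "perm_group S L"
    and N: "Sym.normal_in S N L" "\<not> transitive S N"
    and T: "perm_group S T" "transitive S T" "T \<subseteq> L"
    and w: "w \<in> S" and g: "g \<in> L" "g w = w"
    and comm: "\<And>k. k \<in> T \<Longrightarrow> Sym.commutator S g k \<in> N"
  shows "g \<in> N"
proof (rule semiprimitive_orbit_kernel[OF sp L N])
  fix s assume s: "s \<in> S"
  then obtain k where k: "k \<in> T" "k w = s" using T(2) w unfolding transitive_iff[OF T(1)] by blast
  have B: "g \<in> Bij S" "k \<in> Bij S" using perm_group_Bij[OF L] g(1) k(1) T(3) by auto
  let ?c = "Sym.commutator S g k"
  have "g \<otimes>\<^bsub>BijGroup S\<^esub> k = ?c \<otimes>\<^bsub>BijGroup S\<^esub> (k \<otimes>\<^bsub>BijGroup S\<^esub> g)"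
    using B by (simp add: Sym.commutator_def Sym.m_assoc)
  then have "(g \<otimes>\<^bsub>BijGroup S\<^esub> k) w = (?c \<otimes>\<^bsub>BijGroup S\<^esub> (k \<otimes>\<^bsub>BijGroup S\<^esub> g)) w" by simp
  then have "g s = ?c s" using B w k g by simp
  then show "\<exists>n\<in>N. g s = n s" using comm[OF k(1)] by blast
qed (use w g in auto)

text \<open>Frattini argument: some \<open>k\<close> in \<open>K\<close> moves \<open>w\<close> as
  \<open>l\<close> does, and then \<open>k\<close> inverse times \<open>l\<close> fixes
  \<open>w\<close>.\<close>

lemma transitive_factorisation:
  assumes L: "perm_group S L" and K: "perm_group S K" "transitive S K" "K \<subseteq> L"
    and w: "w \<in> S" and l: "l \<in> L"
  shows "\<exists>k\<in>K. \<exists>a\<in>{g \<in> L. g w = w}. l = k \<otimes>\<^bsub>BijGroup S\<^esub> a"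
proof -
  have lB: "l \<in> Bij S" using L l by (rule perm_group_Bij)
  obtain k where k: "k \<in> K" "k w = l w"
    using K(2) w Bij_mem[OF lB w] unfolding transitive_iff[OF K(1)] by blast
  have kB: "k \<in> Bij S" using K(1) k(1) by (rule perm_group_Bij)
  let ?a = "inv\<^bsub>BijGroup S\<^esub> k \<otimes>\<^bsub>BijGroup S\<^esub> l"
  have "?a w = w" using k(2)[symmetric] kB lB w by simp
  moreover have "?a \<in> L"
    using subgroup.m_closed[OF L subgroup.m_inv_closed[OF L] l] K(3) k(1) by blast
  moreover have "l = k \<otimes>\<^bsub>BijGroup S\<^esub> ?a" using kB lB by simp
  ultimately show ?thesis using k(1) by blast
qed

theorem two_plinths_stabiliser_semisimple:
  assumes sp: "semiprimitive S L" and L: "perm_group S L"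
    and K1: "plinth S L K1" and K2: "plinth S L K2" and ne: "K1 \<noteq> K2" and w: "w \<in> S"
  shows "Sym.semisimple_mod S {\<one>\<^bsub>BijGroup S\<^esub>} {g \<in> L. g w = w}"
  unfolding Sym.semisimple_mod_def
proof (intro conjI allI impI)
  let ?A = "{g \<in> L. g w = w}" and ?one = "\<one>\<^bsub>BijGroup S\<^esub>"
  note LB = perm_group_Bij[OF L]
  have A: "perm_group S ?A" using L w by (rule perm_group_stabiliser)
  show "Sym.normal_in S {?one} ?A" using A by (rule Sym.normal_in_one)
  fix U assume U: "Sym.normal_in S U ?A" and ab: "U \<subseteq> Sym.centraliser_mod S {?one} ?A U"
  have UA: "U \<subseteq> ?A" using U by (rule Sym.normal_inD)
  note p1 = plinthD[OF K1 L] and p2 = plinthD[OF K2 L]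
  have K1s: "perm_group S K1" "K1 \<subseteq> L" using p1(1) by (auto simp: Sym.normal_in_def)
  have K2s: "perm_group S K2" "K2 \<subseteq> L" using p2(1) by (auto simp: Sym.normal_in_def)
  let ?I = "K1 \<inter> K2"
  have I: "Sym.normal_in S ?I L" using p1(1) p2(1) by (rule Sym.normal_in_Int)
  \<comment> \<open>Transitivity would make \<open>?I\<close> equal to both plinths by their
    minimality.\<close>
  have I_intrans: "\<not> transitive S ?I"
  proof
    assume "transitive S ?I"
    then have "?I = K1" "?I = K2" using p1(3)[OF I] p2(3)[OF I] by auto
    then show False using ne by simp
  qed
  let ?P = "{u \<otimes>\<^bsub>BijGroup S\<^esub> k |u k. u \<in> U \<and> k \<in> K2}"
  \<comment> \<open>\<open>L\<close> is the product of \<open>K2\<close> and \<open>?A\<close>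
    because \<open>K2\<close> is transitive, and \<open>?A\<close> normalises
    \<open>U\<close>.\<close>
  have P: "Sym.normal_in S ?P L"
    using transitive_factorisation[OF L K2s(1) p2(2) K2s(2) w]
    by (intro Sym.normal_in_product[OF L p2(1) _ U]) auto
  let ?J = "?P \<inter> K1"
  have J: "Sym.normal_in S ?J L" using P p1(1) by (rule Sym.normal_in_Int)
  have UP: "U \<subseteq> ?P"
  proof
    fix u assume u: "u \<in> U"
    then have "u = u \<otimes>\<^bsub>BijGroup S\<^esub> ?one" using UA LB by auto
    then show "u \<in> ?P" using u subgroup.one_closed[OF K2s(1)] by blast
  qed
  have comm12: "Sym.commutator S x y \<in> M \<inter> N"
    if "Sym.normal_in S M L" "Sym.normal_in S N L" "x \<in> M" "y \<in> N" for M N x y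
    using Sym.commutator_in_Int[OF that(1,2) _ that(3,4)] LB by auto
  \<comment> \<open>The image of \<open>?P\<close> modulo \<open>K2\<close> is that of the abelian group \<open>U\<close>.\<close>
  have P_comm: "Sym.commutator S x y \<in> K2" if x: "x \<in> ?P" and y: "y \<in> ?P" for x y
  proof -
    obtain u k where u: "u \<in> U" "k \<in> K2" "x = u \<otimes>\<^bsub>BijGroup S\<^esub> k" using x by blast
    obtain v m where v: "v \<in> U" "m \<in> K2" "y = v \<otimes>\<^bsub>BijGroup S\<^esub> m" using y by blast
    have yL: "y \<in> L" using y P by (auto simp: Sym.normal_in_def)
    have uvL: "u \<in> L" "v \<in> L" using u v UA by auto
    have B: "u \<in> Bij S" "v \<in> Bij S" "k \<in> Bij S" "m \<in> Bij S" "y \<in> Bij S"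
      using uvL u v yL K2s LB by auto
    have "Sym.commutator S v u = ?one" using ab u v by (auto simp: Sym.centraliser_mod_def)
    \<comment> \<open>Expanding the product \<open>y\<close> leaves a conjugate of the commutator of
      \<open>m\<close> and \<open>u\<close>, which lies in \<open>K2\<close>. After a swap the
      product \<open>x\<close> is expanded in the same way.\<close>
    then have "Sym.commutator S y u = Sym.conjugate S v (Sym.commutator S m u)"
      using B by (simp add: v(3) Sym.commutator_mult_left)
    moreover have "Sym.commutator S m u \<in> K2"
      using Sym.commutator_in_normal[OF p2(1) L] v uvL by blast
    ultimately have "Sym.commutator S y u \<in> K2" using p2(1) uvL by (auto simp: Sym.normal_in_def)
    then have "Sym.commutator S u y \<in> K2"
      using Sym.commutator_swap[of y S u] B subgroup.m_inv_closed[OF K2s(1)] by simp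
    moreover have "Sym.commutator S k y \<in> K2"
      using Sym.commutator_in_normal[OF p2(1) L] u yL by blast
    then have "Sym.conjugate S u (Sym.commutator S k y) \<in> K2"
      using p2(1) uvL by (auto simp: Sym.normal_in_def)
    ultimately show ?thesis
      using B subgroup.m_closed[OF K2s(1)] by (simp add: u(3) Sym.commutator_mult_left)
  qed
  have J_intrans: "\<not> transitive S ?J"
  proof
    assume "transitive S ?J"
    then have "?J = K1" using p1(3)[OF J] by blast
    then have K1P: "K1 \<subseteq> ?P" by blast
    have K1_comm: "Sym.commutator S x y \<in> ?I" if "x \<in> K1" "y \<in> K1" for x y
      using P_comm[of x y] that K1P comm12[OF p1(1) p1(1) that] by blast
    \<comment> \<open>An element \<open>b\<close> of \<open>K2\<close> is factored into
      \<open>a\<close> in \<open>K1\<close> and \<open>g\<close> fixing \<open>w\<close>. Modulo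
      \<open>?I\<close> the group \<open>K1\<close> is abelian and centralised by \<open>K2\<close>,
      so \<open>g\<close> commutes with \<open>K1\<close> modulo \<open>?I\<close> and thus lies in
      \<open>?I\<close>.\<close>
    have "K2 \<subseteq> K1"
    proof
      fix b assume b: "b \<in> K2"
      then obtain a g where a: "a \<in> K1" and g: "g \<in> ?A" and bag: "b = a \<otimes>\<^bsub>BijGroup S\<^esub> g"
        using transitive_factorisation[OF L K1s(1) p1(2) K1s(2) w] K2s(2) by blast
      have B: "a \<in> Bij S" "g \<in> Bij S" "b \<in> Bij S" using a g b K1s K2s LB by auto
      have gab: "g = inv\<^bsub>BijGroup S\<^esub> a \<otimes>\<^bsub>BijGroup S\<^esub> b" using B by (simp add: bag)
      have ia: "inv\<^bsub>BijGroup S\<^esub> a \<in> K1" using a subgroup.m_inv_closed[OF K1s(1)] by blast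
      have "g \<in> ?I"
      proof (rule semiprimitive_commutator_kernel[OF sp L I I_intrans K1s(1) p1(2) K1s(2) w])
        show "g \<in> L" "g w = w" using g by auto
        fix k assume k: "k \<in> K1"
        have kB: "k \<in> Bij S" using k K1s LB by blast
        have "Sym.commutator S b k \<in> ?I" using comm12[OF p2(1) p1(1) b k] by blast
        then have "Sym.conjugate S (inv\<^bsub>BijGroup S\<^esub> a) (Sym.commutator S b k) \<in> ?I"
          using ia K1s(2) I by (auto simp: Sym.normal_in_def)
        moreover have "Sym.commutator S (inv\<^bsub>BijGroup S\<^esub> a) k \<in> ?I" using K1_comm ia k by blast
        ultimately show "Sym.commutator S g k \<in> ?I"
          using B kB subgroup.m_closed[OF Sym.normal_inD(1)[OF I]]
          by (simp add: gab Sym.commutator_mult_left)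
      qed
      then show "b \<in> K1" using a subgroup.m_closed[OF K1s(1)] by (simp add: bag)
    qed
    then show False using p1(3)[OF p2(1)] p2(2) ne by blast
  qed
  show "U \<subseteq> {?one}"
  proof
    fix u assume u: "u \<in> U"
    have uw: "u \<in> L" "u w = w" using u UA by auto
    have uP: "u \<in> ?P" using u UP by blast
    \<comment> \<open>The commutators of \<open>U\<close> with \<open>K1\<close> lie in both normal
      subgroups \<open>?P\<close> and \<open>K1\<close>; this puts \<open>u\<close> into the
      semiregular group \<open>?J\<close>, while \<open>u\<close> fixes \<open>w\<close>.\<close>
    have "u \<in> ?J"
    proof (rule semiprimitive_commutator_kernel[OF sp L J J_intrans K1s(1) p1(2) K1s(2) w uw])
      show "Sym.commutator S u k \<in> ?J" if "k \<in> K1" for k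
        using comm12[OF P p1(1) uP that] .
    qed
    moreover have "semiregular S ?J" using sp L J J_intrans by (rule semiprimitiveD)
    ultimately show "u \<in> {?one}" using w uw(2) unfolding semiregular_iff by blast
  qed
qed

section \<open>Locally semiprimitive graphs\<close>

lemma conjugate_apply:
  assumes "g \<in> Bij V" "n \<in> Bij V" "v \<in> V"
  shows "Sym.conjugate V g n (g v) = g (n v)"
  using assms by (simp add: Sym.conjugate_def Bij_mem)

lemma conjugate_inv_apply:
  assumes "g \<in> Bij V" "n \<in> Bij V" "v \<in> V"
  shows "Sym.conjugate V (inv\<^bsub>BijGroup V\<^esub> g) n v = (inv\<^bsub>BijGroup V\<^esub> g) (n (g v))"
  using conjugate_apply[of "inv\<^bsub>BijGroup V\<^esub> g" V n "g v"] assms by (simp add: Bij_mem)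

lemma finite_perm_group:
  assumes "finite S" "perm_group S L"
  shows "finite L"
proof (rule finite_subset)
  show "L \<subseteq> PiE S (\<lambda>_. S)"
  proof
    fix l assume "l \<in> L"
    with assms(2) have "l \<in> Bij S" by (rule perm_group_Bij)
    then show "l \<in> PiE S (\<lambda>_. S)"
      unfolding PiE_def using Bij_imp_extensional Bij_imp_funcset by (intro IntI)
  qed
  show "finite (PiE S (\<lambda>_. S))" using assms(1) by (simp add: finite_PiE)
qed

section \<open>Homomorphisms from a permutation group to a symmetric group\<close>

context
  fixes V :: "'v set" and P :: "('v \<Rightarrow> 'v) set" and S :: "'a set" and \<pi>
  assumes P: "perm_group V P"
    and \<pi>_Bij: "\<And>g. g \<in> P \<Longrightarrow> \<pi> g \<in> Bij S"
    and \<pi>_mult: "\<And>g h. g \<in> P \<Longrightarrow> h \<in> P \<Longrightarrow>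
      \<pi> (g \<otimes>\<^bsub>BijGroup V\<^esub> h) = \<pi> g \<otimes>\<^bsub>BijGroup S\<^esub> \<pi> h"
begin

lemma action_group_hom: "group_hom (perm_grp V P) (BijGroup S) \<pi>"
proof -
  have "\<pi> \<in> hom (perm_grp V P) (BijGroup S)" using \<pi>_Bij \<pi>_mult by (simp add: hom_def)
  then show ?thesis
    using Sym.subgroup_imp_group[OF P] by (simp add: group_hom_def group_hom_axioms_def)
qed

lemma action_one: "\<pi> \<one>\<^bsub>BijGroup V\<^esub> = \<one>\<^bsub>BijGroup S\<^esub>"
  using group_hom.hom_one[OF action_group_hom] by simp

lemma action_inv: "g \<in> P \<Longrightarrow> \<pi> (inv\<^bsub>BijGroup V\<^esub> g) = inv\<^bsub>BijGroup S\<^esub> \<pi> g"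
  using group_hom.hom_inv[OF action_group_hom, of g] Sym.m_inv_consistent[OF P] by simp

lemma action_conjugate:
  assumes "g \<in> P" "h \<in> P"
  shows "\<pi> (Sym.conjugate V g h) = Sym.conjugate S (\<pi> g) (\<pi> h)"
  using assms
  by (simp add: Sym.conjugate_def \<pi>_mult action_inv subgroup.m_closed[OF P] subgroup.m_inv_closed[OF P])

lemma action_commutator:
  assumes "g \<in> P" "h \<in> P"
  shows "\<pi> (Sym.commutator V g h) = Sym.commutator S (\<pi> g) (\<pi> h)"
  using assms
  by (simp add: Sym.commutator_def \<pi>_mult action_inv subgroup.m_closed[OF P] subgroup.m_inv_closed[OF P])

lemma action_image_perm_group:
  assumes "perm_group V N" "N \<subseteq> P"
  shows "perm_group S (\<pi> ` N)"
  using group_hom.subgroup_img_is_subgroup[OF action_group_hom] Sym.subgroup_incl[OF assms(1) P assms(2)]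
  by blast

lemma action_image_normal_in:
  assumes N: "Sym.normal_in V N A" and A: "A \<subseteq> P"
  shows "Sym.normal_in S (\<pi> ` N) (\<pi> ` A)"
  unfolding Sym.normal_in_def
proof (intro conjI ballI)
  have NA: "N \<subseteq> A" and Ns: "perm_group V N" using N by (auto simp: Sym.normal_in_def)
  show "perm_group S (\<pi> ` N)" using Ns NA A by (intro action_image_perm_group) auto
  show "\<pi> ` N \<subseteq> \<pi> ` A" using NA by blast
  fix h n assume "h \<in> \<pi> ` A" "n \<in> \<pi> ` N"
  then obtain a m where am: "a \<in> A" "h = \<pi> a" "m \<in> N" "n = \<pi> m" by blast
  then have "Sym.conjugate S h n = \<pi> (Sym.conjugate V a m)"
    using NA A by (simp add: action_conjugate subset_iff)
  then show "Sym.conjugate S h n \<in> \<pi> ` N" using Sym.normal_inD(3)[OF N am(1,3)] by blast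
qed

lemma action_kernel_perm_group: "perm_group V {g \<in> P. \<pi> g = \<one>\<^bsub>BijGroup S\<^esub>}"
proof -
  have "subgroup {g \<in> P. \<pi> g = \<one>\<^bsub>BijGroup S\<^esub>} (perm_grp V P)"
    using group_hom.subgroup_kernel[OF action_group_hom] by (simp add: kernel_def)
  then show ?thesis using Sym.incl_subgroup[OF P] by blast
qed

text \<open>An element \<open>g\<close> is determined by its image and by its quotient by a chosen
  element \<open>\<sigma> (\<pi> g)\<close> of the same fibre; that quotient lies in the
  kernel.\<close>

lemma card_le_image_kernel:
  assumes fin: "finite P"
  shows "card P \<le> card (\<pi> ` P) * card {g \<in> P. \<pi> g = \<one>\<^bsub>BijGroup S\<^esub>}"
proof -
  let ?K = "{g \<in> P. \<pi> g = \<one>\<^bsub>BijGroup S\<^esub>}"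
  define \<sigma> where "\<sigma> = inv_into P \<pi>"
  have \<sigma>: "\<sigma> (\<pi> g) \<in> P" "\<pi> (\<sigma> (\<pi> g)) = \<pi> g" if "g \<in> P" for g
    using that by (auto simp: \<sigma>_def inv_into_into f_inv_into_f)
  let ?f = "\<lambda>g. (\<pi> g, inv\<^bsub>BijGroup V\<^esub> \<sigma> (\<pi> g) \<otimes>\<^bsub>BijGroup V\<^esub> g)"
  have "card P \<le> card (\<pi> ` P \<times> ?K)"
  proof (rule card_inj_on_le)
    show "inj_on ?f P"
    proof (rule inj_onI)
      fix g h assume gh: "g \<in> P" "h \<in> P" and eq: "?f g = ?f h"
      have B: "g \<in> Bij V" "h \<in> Bij V" "\<sigma> (\<pi> g) \<in> Bij V"
        using gh \<sigma>(1) perm_group_Bij[OF P] by blast+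
      from eq have "\<pi> g = \<pi> h" by (rule Pair_inject)
      moreover from eq have "inv\<^bsub>BijGroup V\<^esub> \<sigma> (\<pi> g) \<otimes>\<^bsub>BijGroup V\<^esub> g =
          inv\<^bsub>BijGroup V\<^esub> \<sigma> (\<pi> h) \<otimes>\<^bsub>BijGroup V\<^esub> h" by (rule Pair_inject)
      ultimately have "inv\<^bsub>BijGroup V\<^esub> \<sigma> (\<pi> g) \<otimes>\<^bsub>BijGroup V\<^esub> g =
          inv\<^bsub>BijGroup V\<^esub> \<sigma> (\<pi> g) \<otimes>\<^bsub>BijGroup V\<^esub> h" by metis
      then show "g = h" 
        using B by (simp del: BijGroup_closed add: Sym.l_cancel BijGroup_closed(3))
    qed
    have "?f g \<in> \<pi> ` P \<times> ?K" if g: "g \<in> P" for g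
    proof -
      have i: "inv\<^bsub>BijGroup V\<^esub> \<sigma> (\<pi> g) \<in> P" using \<sigma>(1)[OF g] subgroup.m_inv_closed[OF P] by blast
      have "\<pi> (inv\<^bsub>BijGroup V\<^esub> \<sigma> (\<pi> g) \<otimes>\<^bsub>BijGroup V\<^esub> g) = \<one>\<^bsub>BijGroup S\<^esub>"
        using \<pi>_mult[OF i g] action_inv[OF \<sigma>(1)[OF g]] \<sigma>(2)[OF g] Sym.l_inv[of "\<pi> g" S] \<pi>_Bij[OF g]
        by simp
      then show ?thesis using g i subgroup.m_closed[OF P] by blast
    qed
    then show "?f ` P \<subseteq> \<pi> ` P \<times> ?K" by blast
    show "finite (\<pi> ` P \<times> ?K)" using fin by simp
  qed
  then show ?thesis by (simp add: card_cartesian_product)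
qed

end

section \<open>Vertex and arc stabilisers in a locally \<open>L\<close> pair\<close>

context
  fixes S :: "'a set" and L :: "('a \<Rightarrow> 'a) set" and V :: "'v set" and E and G
  assumes L: "perm_group S L" and pair: "locally_pair S L V E G"
begin

lemma pair_subgroup: "perm_group V G"
  using pair by (simp add: locally_pair_def)

lemma pair_Bij: "g \<in> G \<Longrightarrow> g \<in> Bij V"
  using perm_group_Bij[OF pair_subgroup] .

lemma pair_edge: "g \<in> G \<Longrightarrow> u \<in> V \<Longrightarrow> v \<in> V \<Longrightarrow> (g u, g v) \<in> E \<longleftrightarrow> (u, v) \<in> E"
  using pair by (auto simp: locally_pair_def graph_aut_def)

lemma pair_neighbour: "(u, v) \<in> E \<Longrightarrow> u \<in> V" "(u, v) \<in> E \<Longrightarrow> v \<in> V" "(u, v) \<in> E \<Longrightarrow> (v, u) \<in> E"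
  using pair by (auto simp: locally_pair_def simple_graph_def sym_def)

text \<open>Restriction to the neighbourhood followed by the isomorphism onto \<open>L\<close> gives
  an action \<open>\<pi>\<close> of the vertex stabiliser on \<open>S\<close>. The bijection
  \<open>f\<close> matches it with the action on the neighbours, which identifies the
  kernel.\<close>

lemma pair_local_action:
  assumes x: "x \<in> V"
  obtains f \<pi> where "bij_betw f (E `` {x}) S"
    "\<And>g. g \<in> {g \<in> G. g x = x} \<Longrightarrow> \<pi> g \<in> Bij S"
    "\<And>g h. g \<in> {g \<in> G. g x = x} \<Longrightarrow> h \<in> {g \<in> G. g x = x} \<Longrightarrow>
      \<pi> (g \<otimes>\<^bsub>BijGroup V\<^esub> h) = \<pi> g \<otimes>\<^bsub>BijGroup S\<^esub> \<pi> h"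
    "\<pi> ` {g \<in> G. g x = x} = L"
    "\<And>g z. g \<in> {g \<in> G. g x = x} \<Longrightarrow> (x, z) \<in> E \<Longrightarrow> f (g z) = \<pi> g (f z)"
    "\<And>g. g \<in> {g \<in> G. g x = x} \<Longrightarrow>
      \<pi> g = \<one>\<^bsub>BijGroup S\<^esub> \<longleftrightarrow> (\<forall>z. (x, z) \<in> E \<longrightarrow> g z = z)"
proof -
  let ?N = "E `` {x}" and ?P = "{g \<in> G. g x = x}" and ?L = "local_group V E G x"
  have "perm_isomorphic ?N ?L S L" using pair x by (simp add: locally_pair_def)
  then obtain f \<psi> where f: "bij_betw f ?N S" and \<psi>: "\<psi> \<in> iso (perm_grp ?N ?L) (perm_grp S L)"
    and eq: "\<And>h z. h \<in> ?L \<Longrightarrow> z \<in> ?N \<Longrightarrow> f (h z) = \<psi> h (f z)"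
    unfolding perm_isomorphic_def by blast
  have LB: "?L \<subseteq> Bij ?N"
    using pair x by (intro local_group_subset_Bij) (auto simp: locally_pair_def)
  have NV: "?N \<subseteq> V" using pair_neighbour by auto
  have L_eq: "?L = (\<lambda>g. restrict g ?N) ` ?P" by (simp add: local_group_def point_stabiliser_eq)
  have r: "restrict g ?N \<in> ?L" if "g \<in> ?P" for g using that by (simp add: L_eq)
  have \<psi>L: "\<psi> ` ?L = L" using \<psi> by (auto simp: iso_def bij_betw_def)
  define \<pi> where "\<pi> g = \<psi> (restrict g ?N)" for g
  have im: "\<pi> ` ?P = L" using \<psi>L by (simp add: \<pi>_def L_eq image_image)
  have gN: "g z \<in> ?N" if "g \<in> ?P" "z \<in> ?N" for g z
    using that pair_edge[of g x z] x NV by auto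
  have act: "f (g z) = \<pi> g (f z)" if "g \<in> ?P" "(x, z) \<in> E" for g z
    using eq[OF r[OF that(1)], of z] that(2) by (simp add: \<pi>_def)
  have mult: "\<pi> (g \<otimes>\<^bsub>BijGroup V\<^esub> h) = \<pi> g \<otimes>\<^bsub>BijGroup S\<^esub> \<pi> h"
    if g: "g \<in> ?P" and h: "h \<in> ?P" for g h
  proof -
    have B: "g \<in> Bij V" "h \<in> Bij V" using g h pair_Bij by auto
    have rB: "restrict g ?N \<in> Bij ?N" "restrict h ?N \<in> Bij ?N" using r[OF g] r[OF h] LB by auto
    \<comment> \<open>Restriction is multiplicative because \<open>h\<close> maps the neighbourhood
      into itself.\<close>
    have "restrict (g \<otimes>\<^bsub>BijGroup V\<^esub> h) ?N = compose ?N (restrict g ?N) (restrict h ?N)"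
    proof (rule extensionalityI)
      fix z assume z: "z \<in> ?N"
      then have "z \<in> V" using NV by blast
      then show "restrict (g \<otimes>\<^bsub>BijGroup V\<^esub> h) ?N z = compose ?N (restrict g ?N) (restrict h ?N) z"
        using z gN[OF h z] B by (simp add: compose_eq)
    qed simp_all
    then have "restrict (g \<otimes>\<^bsub>BijGroup V\<^esub> h) ?N =
        restrict g ?N \<otimes>\<^bsub>BijGroup ?N\<^esub> restrict h ?N"
      using rB by (simp add: BijGroup_mult)
    then show ?thesis using \<psi> r[OF g] r[OF h] by (simp add: \<pi>_def iso_def hom_def)
  qed
  have L_Bij: "\<pi> g \<in> Bij S" if "g \<in> ?P" for g
    using im that perm_group_Bij[OF L] by blast
  have ker: "\<pi> g = \<one>\<^bsub>BijGroup S\<^esub> \<longleftrightarrow> (\<forall>z. (x, z) \<in> E \<longrightarrow> g z = z)" if g: "g \<in> ?P" for g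
  proof
    assume 1: "\<pi> g = \<one>\<^bsub>BijGroup S\<^esub>"
    show "\<forall>z. (x, z) \<in> E \<longrightarrow> g z = z"
    proof (intro allI impI)
      fix z assume z: "(x, z) \<in> E"
      then have "f z \<in> S" using f by (auto simp: bij_betw_def)
      then have "f (g z) = f z" using act[OF g z] 1 by simp
      then show "g z = z" using f gN[OF g, of z] z by (auto simp: bij_betw_def dest: inj_onD)
    qed
  next
    assume fix_N: "\<forall>z. (x, z) \<in> E \<longrightarrow> g z = z"
    show "\<pi> g = \<one>\<^bsub>BijGroup S\<^esub>"
    proof (rule Bij_eqI[OF L_Bij[OF g]])
      show "\<one>\<^bsub>BijGroup S\<^esub> \<in> Bij S" by simp
      fix s assume s: "s \<in> S"
      then obtain z where z: "(x, z) \<in> E" "s = f z" using f by (auto simp: bij_betw_def)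
      then show "\<pi> g s = \<one>\<^bsub>BijGroup S\<^esub> s" using act[OF g z(1)] fix_N s by simp
    qed
  qed
  show thesis using that[OF f L_Bij mult im act ker] .
qed


lemma pair_local_transitive:
  assumes tr: "transitive S L" and xu: "(x, u) \<in> E" and xv: "(x, v) \<in> E"
  shows "\<exists>g\<in>G. g x = x \<and> g u = v"
proof -
  have xV: "x \<in> V" using xu by (rule pair_neighbour)
  let ?P = "{g \<in> G. g x = x}"
  obtain f \<pi> where f: "bij_betw f (E `` {x}) S" and im: "\<pi> ` ?P = L"
    and act: "\<And>g z. g \<in> ?P \<Longrightarrow> (x, z) \<in> E \<Longrightarrow> f (g z) = \<pi> g (f z)"
    using pair_local_action[OF xV] by blast
  have "f u \<in> S" "f v \<in> S" using f xu xv by (auto simp: bij_betw_def)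
  then obtain l where "l \<in> L" "l (f u) = f v" using tr unfolding transitive_iff[OF L] by blast
  then obtain p where p: "p \<in> ?P" "\<pi> p (f u) = f v" using im by blast
  then have eq: "f (p u) = f v" using act[OF p(1) xu] by simp
  have "(p x, p u) \<in> E" using pair_edge[of p x u] p(1) xu pair_neighbour[OF xu] by blast
  then have "p u \<in> E `` {x}" using p(1) by simp
  then have "p u = v" using f eq xv by (auto simp: bij_betw_def dest: inj_onD)
  then show ?thesis using p(1) by blast
qed

text \<open>Vertex-transitivity gives \<open>g\<close> with \<open>g x = y\<close>. Both
  \<open>g y\<close> and \<open>x\<close> are neighbours of \<open>y\<close>, so an element fixing
  \<open>y\<close> brings \<open>g y\<close> back to \<open>x\<close>.\<close>

lemma pair_swap:
  assumes tr: "transitive S L" and xy: "(x, y) \<in> E"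
  obtains t where "t \<in> G" "t x = y" "t y = x"
proof -
  note xV = pair_neighbour(1)[OF xy] and yV = pair_neighbour(2)[OF xy]
  have "transitive V G" using pair by (simp add: locally_pair_def)
  then obtain g where g: "g \<in> G" "g x = y"
    using xV yV unfolding transitive_iff[OF pair_subgroup] by blast
  have "(g x, g y) \<in> E" using xy pair_edge[OF g(1) xV yV] by simp
  then have gy: "(y, g y) \<in> E" using g by simp
  obtain h where h: "h \<in> G" "h y = y" "h (g y) = x"
    using pair_local_transitive[OF tr gy pair_neighbour(3)[OF xy]] by blast
  show thesis
  proof (rule that)
    show "h \<otimes>\<^bsub>BijGroup V\<^esub> g \<in> G" using h(1) g(1) subgroup.m_closed[OF pair_subgroup] by blast
    show "(h \<otimes>\<^bsub>BijGroup V\<^esub> g) x = y" "(h \<otimes>\<^bsub>BijGroup V\<^esub> g) y = x"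
      using g h xV yV pair_Bij by simp_all
  qed
qed

text \<open>Every vertex in the orbit of \<open>x\<close> under the normaliser of \<open>N\<close> is fixed by \<open>N\<close>, and that
  orbit is closed under taking neighbours.\<close>

lemma pair_core_trivial:
  assumes tr: "transitive S L" and xy: "(x, y) \<in> E" and t: "t \<in> G" "t x = y" "t y = x"
    and N: "perm_group V N" "N \<subseteq> {g \<in> G. g x = x \<and> g y = y}"
    and inv_N: "\<And>g n. g \<in> insert t {g \<in> G. g x = x} \<Longrightarrow> n \<in> N \<Longrightarrow> Sym.conjugate V g n \<in> N"
  shows "N \<subseteq> {\<one>\<^bsub>BijGroup V\<^esub>}"
proof
  note xV = pair_neighbour(1)[OF xy] and yV = pair_neighbour(2)[OF xy]
  note mc = subgroup.m_closed[OF pair_subgroup] and ic = subgroup.m_inv_closed[OF pair_subgroup]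
  have NB: "n \<in> Bij V" if "n \<in> N" for n using that N(1) by (rule perm_group_Bij[rotated])
  have tB: "t \<in> Bij V" using t(1) by (rule pair_Bij)
  have inv_P: "Sym.conjugate V (inv\<^bsub>BijGroup V\<^esub> p) n \<in> N"
    if p: "p \<in> G" "p x = x" and n: "n \<in> N" for p n
  proof (rule inv_N[OF _ n])
    have "(inv\<^bsub>BijGroup V\<^esub> p) x = x" using inv_BijGroup_apply(1)[OF pair_Bij[OF p(1)] xV] p(2) by simp
    then show "inv\<^bsub>BijGroup V\<^esub> p \<in> insert t {g \<in> G. g x = x}" using ic[OF p(1)] by blast
  qed
  have inv_t: "Sym.conjugate V (inv\<^bsub>BijGroup V\<^esub> t) n \<in> N" if n: "n \<in> N" for n
  proof -
    \<comment> \<open>The inverse of \<open>t\<close> is \<open>t\<close> times the inverse of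
      \<open>?s\<close>, and \<open>?s\<close> fixes \<open>x\<close>; both factors are covered by
      the invariance of \<open>N\<close>.\<close>
    let ?s = "t \<otimes>\<^bsub>BijGroup V\<^esub> t"
    have "?s \<in> G" "?s x = x" using t tB xV mc by simp_all
    then have "Sym.conjugate V (inv\<^bsub>BijGroup V\<^esub> ?s) n \<in> N" using n by (rule inv_P)
    then have "Sym.conjugate V t (Sym.conjugate V (inv\<^bsub>BijGroup V\<^esub> ?s) n) \<in> N" using inv_N by blast
    moreover have "t \<otimes>\<^bsub>BijGroup V\<^esub> inv\<^bsub>BijGroup V\<^esub> ?s = inv\<^bsub>BijGroup V\<^esub> t"
      using tB by (simp add: Sym.inv_mult_group)
    ultimately show ?thesis using tB NB[OF n] by (simp add: Sym.conjugate_conjugate)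
  qed
  have orbit: "\<exists>g\<in>G. g x = v \<and> (\<forall>n\<in>N. Sym.conjugate V (inv\<^bsub>BijGroup V\<^esub> g) n \<in> N)"
    if "(x, v) \<in> E\<^sup>*" for v
    using that
  proof (induction rule: rtrancl_induct)
    case base
    have "Sym.conjugate V (inv\<^bsub>BijGroup V\<^esub> \<one>\<^bsub>BijGroup V\<^esub>) n \<in> N" if "n \<in> N" for n
      using that NB by simp
    then show ?case using subgroup.one_closed[OF pair_subgroup] xV one_BijGroup_apply by metis
  next
    case (step v u)
    then obtain g where g: "g \<in> G" "g x = v"
      and gN: "\<And>n. n \<in> N \<Longrightarrow> Sym.conjugate V (inv\<^bsub>BijGroup V\<^esub> g) n \<in> N" by blast
    have gB: "g \<in> Bij V" using g(1) by (rule pair_Bij)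
    have uV: "u \<in> V" using step.hyps(2) by (rule pair_neighbour)
    let ?z = "(inv\<^bsub>BijGroup V\<^esub> g) u"
    have zV: "?z \<in> V" and gz: "g ?z = u" using gB uV by (simp_all add: Bij_mem inv_BijGroup_apply_right)
    have "(x, ?z) \<in> E" using pair_edge[OF g(1) xV zV] g(2) gz step.hyps(2) by simp
    then obtain p where p: "p \<in> G" "p x = x" "p y = ?z" using pair_local_transitive[OF tr xy] by blast
    have pB: "p \<in> Bij V" using p(1) by (rule pair_Bij)
    \<comment> \<open>\<open>t\<close> moves \<open>x\<close> to \<open>y\<close>, \<open>p\<close>
      moves \<open>y\<close> to \<open>?z\<close>, and \<open>g\<close> moves \<open>?z\<close> to
      \<open>u\<close>.\<close>
    let ?h = "g \<otimes>\<^bsub>BijGroup V\<^esub> (p \<otimes>\<^bsub>BijGroup V\<^esub> t)"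
    have "?h \<in> G" using g(1) p(1) t(1) mc by blast
    moreover have "?h x = u" using gB pB tB xV t p gz by simp
    moreover have "Sym.conjugate V (inv\<^bsub>BijGroup V\<^esub> ?h) n \<in> N" if n: "n \<in> N" for n
    proof -
      have "Sym.conjugate V (inv\<^bsub>BijGroup V\<^esub> ?h) n =
          Sym.conjugate V (inv\<^bsub>BijGroup V\<^esub> t) (Sym.conjugate V (inv\<^bsub>BijGroup V\<^esub> p)
            (Sym.conjugate V (inv\<^bsub>BijGroup V\<^esub> g) n))"
        using gB pB tB NB[OF n] by (simp add: Sym.conjugate_conjugate Sym.inv_mult_group Sym.m_assoc)
      then show ?thesis using inv_t inv_P[OF p(1,2)] gN[OF n] by simp
    qed
    ultimately show ?case by blast
  qed
  fix n assume n: "n \<in> N"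
  have "n v = v" if v: "v \<in> V" for v
  proof -
    have "(x, v) \<in> E\<^sup>*" using pair xV v by (auto simp: locally_pair_def connected_graph_def)
    then obtain g where g: "g \<in> G" "g x = v" "Sym.conjugate V (inv\<^bsub>BijGroup V\<^esub> g) n \<in> N"
      using orbit n by blast
    have gB: "g \<in> Bij V" using g(1) by (rule pair_Bij)
    have nvV: "n v \<in> V" using Bij_mem[OF NB[OF n] v] .
    \<comment> \<open>The conjugate of \<open>n\<close> by the inverse of \<open>g\<close> fixes
      \<open>x\<close>, so \<open>n\<close> itself fixes \<open>g x = v\<close>.\<close>
    have "Sym.conjugate V (inv\<^bsub>BijGroup V\<^esub> g) n x = x" using g(3) N(2) by blast
    then have "(inv\<^bsub>BijGroup V\<^esub> g) (n v) = x" using conjugate_inv_apply[OF gB NB[OF n] xV] g(2) by simp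
    then have "g x = n v" using inv_BijGroup_apply(2)[OF gB nvV] by simp
    then show ?thesis using g(2) by simp
  qed
  then have "n = \<one>\<^bsub>BijGroup V\<^esub>" using NB[OF n] by (intro Bij_eqI[of _ V]) simp_all
  then show "n \<in> {\<one>\<^bsub>BijGroup V\<^esub>}" by simp
qed

text \<open>Instance of \<open>edge_kernel_trivial\<close> for the vertex stabiliser
  \<open>?P\<close>, the arc stabiliser \<open>?A\<close>, the kernel \<open>?K\<close> on the
  neighbourhood of \<open>x\<close> and an element \<open>t\<close> reversing the edge.\<close>

lemma pair_edge_kernel_trivial:
  assumes sp: "semiprimitive S L"
    and ss: "\<And>w. w \<in> S \<Longrightarrow> Sym.semisimple_mod S {\<one>\<^bsub>BijGroup S\<^esub>} {g \<in> L. g w = w}"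
    and xy: "(x, y) \<in> E" and fin: "finite {g \<in> G. g x = x}"
    and g: "g \<in> G" "\<And>z. (x, z) \<in> E \<Longrightarrow> g z = z" "\<And>z. (y, z) \<in> E \<Longrightarrow> g z = z"
  shows "g = \<one>\<^bsub>BijGroup V\<^esub>"
proof -
  note xV = pair_neighbour(1)[OF xy] and yV = pair_neighbour(2)[OF xy]
  note mc = subgroup.m_closed[OF pair_subgroup] and ic = subgroup.m_inv_closed[OF pair_subgroup]
  have tr: "transitive S L" using sp by (simp add: semiprimitive_def)
  let ?P = "{g \<in> G. g x = x}" and ?A = "{g \<in> G. g x = x \<and> g y = y}"
  obtain f \<pi> where f: "bij_betw f (E `` {x}) S"
    and \<pi>B: "\<And>g. g \<in> ?P \<Longrightarrow> \<pi> g \<in> Bij S"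
    and \<pi>m: "\<And>g h. g \<in> ?P \<Longrightarrow> h \<in> ?P \<Longrightarrow> \<pi> (g \<otimes>\<^bsub>BijGroup V\<^esub> h) = \<pi> g \<otimes>\<^bsub>BijGroup S\<^esub> \<pi> h"
    and im: "\<pi> ` ?P = L"
    and act: "\<And>g z. g \<in> ?P \<Longrightarrow> (x, z) \<in> E \<Longrightarrow> f (g z) = \<pi> g (f z)"
    and ker: "\<And>g. g \<in> ?P \<Longrightarrow> \<pi> g = \<one>\<^bsub>BijGroup S\<^esub> \<longleftrightarrow> (\<forall>z. (x, z) \<in> E \<longrightarrow> g z = z)"
    using pair_local_action[OF xV] by blast
  let ?K = "{g \<in> ?P. \<pi> g = \<one>\<^bsub>BijGroup S\<^esub>}"
  define w where "w = f y"
  have w: "w \<in> S" using f xy by (auto simp: w_def bij_betw_def)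
  have P: "perm_group V ?P" using pair_subgroup xV by (rule perm_group_stabiliser)
  have A_eq: "?A = {g \<in> ?P. g y = y}" by auto
  have A: "perm_group V ?A" unfolding A_eq using P yV by (rule perm_group_stabiliser)
  \<comment> \<open>\<open>f\<close> is injective on the neighbours of \<open>x\<close>, so the
    action on \<open>S\<close> at \<open>w = f y\<close> records where \<open>y\<close>
    goes.\<close>
  have fix_iff: "\<pi> p w = \<pi> q w \<longleftrightarrow> p y = q y" if "p \<in> ?P" "q \<in> ?P" for p q
  proof -
    have "(p x, p y) \<in> E" "(q x, q y) \<in> E"
      using that xy pair_edge[of p, OF _ xV yV] pair_edge[of q, OF _ xV yV] by blast+
    then have "p y \<in> E `` {x}" "q y \<in> E `` {x}" using that by simp_all
    then show ?thesis
      using act[OF that(1) xy] act[OF that(2) xy] inj_on_eq_iff[OF bij_betw_imp_inj_on[OF f]]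
      unfolding w_def by metis
  qed
  have oneP: "\<one>\<^bsub>BijGroup V\<^esub> \<in> ?P" using P by (rule subgroup.one_closed)
  have \<pi>1: "\<pi> \<one>\<^bsub>BijGroup V\<^esub> = \<one>\<^bsub>BijGroup S\<^esub>" using P \<pi>B \<pi>m by (rule action_one)
  have \<pi>_conj: "\<pi> (Sym.conjugate V g h) = Sym.conjugate S (\<pi> g) (\<pi> h)"
    if "g \<in> ?P" "h \<in> ?P" for g h
    using P \<pi>B \<pi>m that by (rule action_conjugate)
  have \<pi>_comm: "\<pi> (Sym.commutator V g h) = Sym.commutator S (\<pi> g) (\<pi> h)"
    if "g \<in> ?P" "h \<in> ?P" for g h
    using P \<pi>B \<pi>m that by (rule action_commutator)
  have fix_w: "\<pi> p w = w \<longleftrightarrow> p y = y" if "p \<in> ?P" for p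
    using fix_iff[OF that oneP] w yV by (simp add: \<pi>1)
  have imA: "\<pi> ` ?A = {l \<in> L. l w = w}"
  proof
    show "\<pi> ` ?A \<subseteq> {l \<in> L. l w = w}" using fix_w im by blast
    show "{l \<in> L. l w = w} \<subseteq> \<pi> ` ?A" using fix_w unfolding im[symmetric] by blast
  qed
  have KA: "?K \<subseteq> ?A"
  proof
    fix k assume k: "k \<in> ?K"
    then have "k \<in> ?P" "\<pi> k w = w" using w by simp_all
    then show "k \<in> ?A" using fix_w by blast
  qed
  obtain t where t: "t \<in> G" "t x = y" "t y = x" using pair_swap[OF tr xy] by blast
  have tB: "t \<in> Bij V" using t(1) by (rule pair_Bij)
  have inv_t: "inv\<^bsub>BijGroup V\<^esub> t \<in> G" "(inv\<^bsub>BijGroup V\<^esub> t) x = y" "(inv\<^bsub>BijGroup V\<^esub> t) y = x"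
    using t ic inv_BijGroup_apply(1)[OF tB xV] inv_BijGroup_apply(1)[OF tB yV] by auto
  have swap_A: "Sym.conjugate V s a \<in> ?A" if s: "s \<in> G" "s x = y" "s y = x" and a: "a \<in> ?A" for s a
  proof -
    have B: "s \<in> Bij V" "a \<in> Bij V" using s a pair_Bij by auto
    have "Sym.conjugate V s a \<in> G"
      using Sym.normal_inD(3)[OF Sym.normal_in_self[OF pair_subgroup]] s a by blast
    then show ?thesis using conjugate_apply[OF B xV] conjugate_apply[OF B yV] s a by simp
  qed
  have tA: "Sym.conjugate V t ` ?A = ?A"
  proof
    show "Sym.conjugate V t ` ?A \<subseteq> ?A" using swap_A[OF t] by blast
    show "?A \<subseteq> Sym.conjugate V t ` ?A"
    proof
      fix a assume a: "a \<in> ?A"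
      then have "a = Sym.conjugate V t (Sym.conjugate V (inv\<^bsub>BijGroup V\<^esub> t) a)"
        using tB pair_Bij by simp
      then show "a \<in> Sym.conjugate V t ` ?A" using swap_A[OF inv_t a] by blast
    qed
  qed
  have tt: "t \<otimes>\<^bsub>BijGroup V\<^esub> t \<in> ?A" using t tB mc xV yV by simp
  have K_normal: "Sym.normal_in V ?K ?P"
    unfolding Sym.normal_in_def
  proof (intro conjI ballI)
    show "?K \<subseteq> ?P" by blast
    show "perm_group V ?K" using P \<pi>B \<pi>m by (rule action_kernel_perm_group)
    fix h n assume h: "h \<in> ?P" and n: "n \<in> ?K"
    have "Sym.conjugate V h n \<in> ?P"
      using Sym.normal_inD(3)[OF Sym.normal_in_self[OF P]] h n by blast
    moreover have "\<pi> (Sym.conjugate V h n) = \<one>\<^bsub>BijGroup S\<^esub>"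
      using \<pi>_conj[of h n] h n \<pi>B[OF h] by simp
    ultimately show "Sym.conjugate V h n \<in> ?K" by blast
  qed
  \<comment> \<open>\<open>\<pi>\<close> maps \<open>?A\<close> onto the stabiliser of
    \<open>w\<close> in \<open>L\<close> with kernel \<open>?K\<close>, so a normal subgroup that is
    abelian modulo \<open>?K\<close> has an abelian normal image, which is trivial by
    \<open>ss\<close>.\<close>
  have ssK: "Sym.semisimple_mod V ?K ?A"
    unfolding Sym.semisimple_mod_def
  proof (intro conjI allI impI)
    show "Sym.normal_in V ?K ?A" using K_normal KA by (rule Sym.normal_in_subset) blast
    fix U assume U: "Sym.normal_in V U ?A" and ab: "U \<subseteq> Sym.centraliser_mod V ?K ?A U"
    have UP: "U \<subseteq> ?P" using U by (auto simp: Sym.normal_in_def)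
    have "?A \<subseteq> ?P" by blast
    with P \<pi>B \<pi>m U have "Sym.normal_in S (\<pi> ` U) (\<pi> ` ?A)" by (rule action_image_normal_in)
    then have n: "Sym.normal_in S (\<pi> ` U) {l \<in> L. l w = w}" by (simp only: imA)
    have "Sym.commutator S (\<pi> u) (\<pi> v) = \<one>\<^bsub>BijGroup S\<^esub>" if uv: "u \<in> U" "v \<in> U" for u v
    proof -
      have "Sym.commutator V u v \<in> ?K" using ab uv by (auto simp: Sym.centraliser_mod_def)
      then have "\<pi> (Sym.commutator V u v) = \<one>\<^bsub>BijGroup S\<^esub>" by blast
      moreover have "u \<in> ?P" "v \<in> ?P" using uv UP by blast+
      ultimately show ?thesis by (simp only: \<pi>_comm)
    qed
    then have "Sym.commutator S a b \<in> {\<one>\<^bsub>BijGroup S\<^esub>}" if "a \<in> \<pi> ` U" "b \<in> \<pi> ` U" for a b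
      using that by fast
    then have "\<pi> ` U \<subseteq> Sym.centraliser_mod S {\<one>\<^bsub>BijGroup S\<^esub>} {l \<in> L. l w = w} (\<pi> ` U)"
      using Sym.normal_inD(2)[OF n] unfolding Sym.centraliser_mod_def by (intro subsetI CollectI) fast
    then have "\<pi> ` U \<subseteq> {\<one>\<^bsub>BijGroup S\<^esub>}" using ss[OF w] n by (simp add: Sym.semisimple_mod_def)
    then show "U \<subseteq> ?K" using UP by blast
  qed
  \<comment> \<open>The image of \<open>C\<close> is normal in \<open>L\<close>, hence transitive or
    semiregular. In the first case some \<open>c\<close> in \<open>C\<close> moves \<open>y\<close>
    as \<open>p\<close> does; in the second an element of \<open>C\<close> fixing \<open>y\<close>
    acts trivially on the neighbourhood of \<open>x\<close>.\<close>
  have dich: "C \<inter> ?A \<subseteq> ?K \<or> (\<forall>p\<in>?P. \<exists>c\<in>C. \<exists>a\<in>?A. p = c \<otimes>\<^bsub>BijGroup V\<^esub> a)"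
    if C: "Sym.normal_in V C ?P" for C
  proof -
    have CP: "C \<subseteq> ?P" using C by (rule Sym.normal_inD)
    from P \<pi>B \<pi>m C subset_refl have "Sym.normal_in S (\<pi> ` C) (\<pi> ` ?P)"
      by (rule action_image_normal_in)
    then have n: "Sym.normal_in S (\<pi> ` C) L" by (simp only: im)
    show ?thesis
    proof (cases "transitive S (\<pi> ` C)")
      case True
      have "\<exists>c\<in>C. \<exists>a\<in>?A. p = c \<otimes>\<^bsub>BijGroup V\<^esub> a" if p: "p \<in> ?P" for p
      proof -
        have "\<pi> p w \<in> S" using \<pi>B[OF p] w by (rule Bij_mem)
        then obtain c where c: "c \<in> C" "\<pi> c w = \<pi> p w"
          using True w unfolding transitive_iff[OF Sym.normal_inD(1)[OF n]] by blast
        have cP: "c \<in> ?P" using c(1) CP by blast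
        have cy: "c y = p y" using fix_iff[OF cP p] c(2) by simp
        have B: "c \<in> Bij V" "p \<in> Bij V" using cP p pair_Bij by auto
        let ?a = "inv\<^bsub>BijGroup V\<^esub> c \<otimes>\<^bsub>BijGroup V\<^esub> p"
        have "?a \<in> ?P" using subgroup.m_closed[OF P subgroup.m_inv_closed[OF P cP] p] .
        moreover have "?a y = y" using B yV cy[symmetric] by simp
        moreover have "p = c \<otimes>\<^bsub>BijGroup V\<^esub> ?a" using B by simp
        ultimately show ?thesis using c(1) by blast
      qed
      then show ?thesis by blast
    next
      case False
      with sp L n have sr: "semiregular S (\<pi> ` C)" by (rule semiprimitiveD)
      have "c \<in> ?K" if c: "c \<in> C \<inter> ?A" for c
      proof -
        have cP: "c \<in> ?P" using c by blast
        have "\<pi> c w = w" using fix_w[OF cP] c by blast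
        then have "\<pi> c = \<one>\<^bsub>BijGroup S\<^esub>" using sr w c unfolding semiregular_iff by blast
        then show ?thesis using cP by blast
      qed
      then show ?thesis by blast
    qed
  qed
  have D: "?K \<inter> Sym.conjugate V t ` ?K \<subseteq> {\<one>\<^bsub>BijGroup V\<^esub>}"
  proof (rule Sym.edge_kernel_trivial[OF P fin A _ K_normal KA _ tA tt _ ssK dich])
    show "?A \<subseteq> ?P" by blast
    show "t \<in> carrier (BijGroup V)" using tB by simp
  qed (use pair_core_trivial[OF tr xy t] in blast)
  have gB: "g \<in> Bij V" using g(1) by (rule pair_Bij)
  have "g x = x" using g(3)[OF pair_neighbour(3)[OF xy]] .
  moreover have "g y = y" using g(2)[OF xy] .
  ultimately have gA: "g \<in> ?A" using g(1) by blast
  then have "g \<in> ?P" by blast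
  then have gK: "g \<in> ?K" using ker[of g] g(2) by blast
  \<comment> \<open>\<open>t\<close> maps neighbours of \<open>x\<close> to neighbours of
    \<open>y\<close>, all fixed by \<open>g\<close>; so \<open>?g\<close> lies in \<open>?K\<close>,
    and \<open>g\<close> in the conjugate of \<open>?K\<close> by \<open>t\<close>.\<close>
  let ?g = "Sym.conjugate V (inv\<^bsub>BijGroup V\<^esub> t) g"
  have g'A: "?g \<in> ?A" using swap_A[OF inv_t gA] .
  have "?g z = z" if z: "(x, z) \<in> E" for z
  proof -
    have zV: "z \<in> V" using z by (rule pair_neighbour)
    have "(t x, t z) \<in> E" using pair_edge[OF t(1) xV zV] z by simp
    then have "g (t z) = t z" using t(2) g(3) by simp
    then show ?thesis using conjugate_inv_apply[OF tB gB zV] tB zV by simp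
  qed
  then have "?g \<in> ?K" using ker[of ?g] g'A by blast
  moreover have "g = Sym.conjugate V t ?g" using tB gB by simp
  ultimately show ?thesis using D gK by blast
qed

text \<open>The stabiliser of \<open>x\<close> modulo \<open>?K\<close> is \<open>L\<close>. The
  group \<open>?K\<close> acts faithfully on the neighbourhood of \<open>y\<close>, since an element
  trivial there fixes both neighbourhoods. Each of the two actions contributes a factor of at most
  \<open>card L\<close>.\<close>

lemma pair_stabiliser_card_le:
  assumes sp: "semiprimitive S L" and finS: "finite S"
    and ss: "\<And>w. w \<in> S \<Longrightarrow> Sym.semisimple_mod S {\<one>\<^bsub>BijGroup S\<^esub>} {g \<in> L. g w = w}"
    and xy: "(x, y) \<in> E" and fin: "finite {g \<in> G. g x = x}"
  shows "card {g \<in> G. g x = x} \<le> card L * card L"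
proof -
  note xV = pair_neighbour(1)[OF xy] and yV = pair_neighbour(2)[OF xy]
  let ?P = "\<lambda>v. {g \<in> G. g v = v}"
  have finL: "finite L" using finS L by (rule finite_perm_group)
  have P: "perm_group V (?P v)" if "v \<in> V" for v
    using pair_subgroup that by (rule perm_group_stabiliser)
  obtain \<pi> where \<pi>B: "\<And>g. g \<in> ?P x \<Longrightarrow> \<pi> g \<in> Bij S"
    and \<pi>m: "\<And>g h. g \<in> ?P x \<Longrightarrow> h \<in> ?P x \<Longrightarrow>
      \<pi> (g \<otimes>\<^bsub>BijGroup V\<^esub> h) = \<pi> g \<otimes>\<^bsub>BijGroup S\<^esub> \<pi> h"
    and im: "\<pi> ` ?P x = L"
    and ker: "\<And>g. g \<in> ?P x \<Longrightarrow> \<pi> g = \<one>\<^bsub>BijGroup S\<^esub> \<longleftrightarrow> (\<forall>z. (x, z) \<in> E \<longrightarrow> g z = z)"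
    using pair_local_action[OF xV] by blast
  obtain \<rho> where \<rho>B: "\<And>g. g \<in> ?P y \<Longrightarrow> \<rho> g \<in> Bij S"
    and \<rho>m: "\<And>g h. g \<in> ?P y \<Longrightarrow> h \<in> ?P y \<Longrightarrow>
      \<rho> (g \<otimes>\<^bsub>BijGroup V\<^esub> h) = \<rho> g \<otimes>\<^bsub>BijGroup S\<^esub> \<rho> h"
    and im': "\<rho> ` ?P y = L"
    and ker': "\<And>g. g \<in> ?P y \<Longrightarrow> \<rho> g = \<one>\<^bsub>BijGroup S\<^esub> \<longleftrightarrow> (\<forall>z. (y, z) \<in> E \<longrightarrow> g z = z)"
    using pair_local_action[OF yV] by blast
  let ?K = "{g \<in> ?P x. \<pi> g = \<one>\<^bsub>BijGroup S\<^esub>}"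
  have K: "perm_group V ?K" using P[OF xV] \<pi>B \<pi>m by (rule action_kernel_perm_group)
  have KP: "?K \<subseteq> ?P y"
  proof
    fix g assume g: "g \<in> ?K"
    then have "g y = y" using ker[of g] xy by simp
    then show "g \<in> ?P y" using g by simp
  qed
  have finK: "finite ?K" using fin by (rule finite_subset[rotated]) blast
  have "{g \<in> ?K. \<rho> g = \<one>\<^bsub>BijGroup S\<^esub>} \<subseteq> {\<one>\<^bsub>BijGroup V\<^esub>}"
  proof
    fix g assume g: "g \<in> {g \<in> ?K. \<rho> g = \<one>\<^bsub>BijGroup S\<^esub>}"
    then have gx: "g \<in> ?P x" and gy: "g \<in> ?P y" using KP by auto
    have "g = \<one>\<^bsub>BijGroup V\<^esub>"
    proof (rule pair_edge_kernel_trivial[OF sp ss xy fin])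
      show "g \<in> G" using gx by blast
      show "g z = z" if "(x, z) \<in> E" for z using ker[OF gx] g that by blast
      show "g z = z" if "(y, z) \<in> E" for z using ker'[OF gy] g that by blast
    qed
    then show "g \<in> {\<one>\<^bsub>BijGroup V\<^esub>}" by simp
  qed
  then have k1: "card {g \<in> ?K. \<rho> g = \<one>\<^bsub>BijGroup S\<^esub>} \<le> 1"
    using card_mono[of "{\<one>\<^bsub>BijGroup V\<^esub>}"] by simp
  have k2: "card ?K \<le> card (\<rho> ` ?K) * card {g \<in> ?K. \<rho> g = \<one>\<^bsub>BijGroup S\<^esub>}"
  proof (rule card_le_image_kernel[OF K _ _ finK])
    show "\<rho> g \<in> Bij S" if "g \<in> ?K" for g using \<rho>B that KP by blast
    show "\<rho> (g \<otimes>\<^bsub>BijGroup V\<^esub> h) = \<rho> g \<otimes>\<^bsub>BijGroup S\<^esub> \<rho> h"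
      if "g \<in> ?K" "h \<in> ?K" for g h
      using \<rho>m that KP by blast
  qed
  have "\<rho> ` ?K \<subseteq> L" using image_mono[OF KP, of \<rho>] by (simp only: im')
  with finL have k3: "card (\<rho> ` ?K) \<le> card L" by (rule card_mono)
  have "card ?K \<le> card L * 1" using k2 mult_le_mono[OF k3 k1] by (rule order_trans)
  then have "card L * card ?K \<le> card L * card L" by simp
  moreover have "card (?P x) \<le> card (\<pi> ` ?P x) * card ?K"
    using P[OF xV] \<pi>B \<pi>m fin by (rule card_le_image_kernel)
  ultimately show ?thesis unfolding im by linarith
qed

end

section \<open>From the local bound to a constant depending on \<open>L\<close> alone\<close>

theorem theorem1p4:
  fixes S :: "'a set" and L :: "('a \<Rightarrow> 'a) set"
  assumes "finite S"
    and "perm_group S L"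
    and "semiprimitive S L"
    and "\<exists>K1 K2. plinth S L K1 \<and> plinth S L K2 \<and> K1 \<noteq> K2"
  shows "graph_restrictive S L"
proof -
  obtain K1 K2 where K: "plinth S L K1" "plinth S L K2" "K1 \<noteq> K2" using assms(4) by blast
  have ss: "Sym.semisimple_mod S {\<one>\<^bsub>BijGroup S\<^esub>} {g \<in> L. g w = w}" if "w \<in> S" for w
    using two_plinths_stabiliser_semisimple[OF assms(3,2) K that] .
  \<comment> \<open>On the empty set the trivial group is the only permutation group, so two
    distinct plinths cannot exist.\<close>
  have "S \<noteq> {}"
  proof
    assume "S = {}"
    then have "M = {\<one>\<^bsub>BijGroup S\<^esub>}" if "perm_group S M" for M
      using perm_group_Bij[OF that] subgroup.one_closed[OF that] Bij_eqI[of _ S "\<one>\<^bsub>BijGroup S\<^esub>"]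
      by auto
    then show False
      using K plinthD(1)[OF K(1) assms(2)] plinthD(1)[OF K(2) assms(2)] Sym.normal_inD(1) by metis
  qed
  then obtain s where s: "s \<in> S" by blast
  show ?thesis
    unfolding graph_restrictive_def point_stabiliser_eq
  proof (intro exI allI impI ballI)
    fix V :: "nat set" and E G x
    assume pair: "locally_pair S L V E G" and fin: "\<forall>x\<in>V. finite {g \<in> G. g x = x}" and x: "x \<in> V"
    \<comment> \<open>The bound is stated for an edge at \<open>x\<close>; a neighbour of
      \<open>x\<close> comes from a point of the nonempty set \<open>S\<close> through
      \<open>f\<close>.\<close>
    obtain f where "bij_betw f (E `` {x}) S" using pair_local_action[OF assms(2) pair x] by metis
    then obtain y where "(x, y) \<in> E" using s by (auto simp: bij_betw_def)
    then show "card {g \<in> G. g x = x} \<le> card L * card L"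
      using pair_stabiliser_card_le[OF assms(2) pair assms(3,1) ss] fin x by blast
  qed
qed

end
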